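(* Let $p\in[1,\infty)$ and let $b=(b_n)_{n=0}^\infty\in\mathscr{M}(d_p)$ satisfy $$\Big\|T_b-\sum_{j=0}^n b_jS^j\Big\|_{\mathscr{M}_{\mathrm{op}}(d_p)}\to0\quad\text{for } n\to\infty.$$ Then $$\sigma(T_b;\mathscr{A}(S,d_p))=\Big\{\sum_{n=0}^\infty b_n\lambda^n:\lambda\in\overline{\mathbb{D}}\Big\}\subseteq\sigma(T_b;\mathscr{M}_{\mathrm{op}}(d_p))=\sigma(T_b;\mathscr{L}(d_p)).$$
   Context: Let $\mathbb{N}_0=\{0,1,2,\dots\}$ and $\overline{\mathbb{D}}=\{z\in\mathbb{C}:|z|\le1\}$. For $p\in[1,\infty)$, $d_p$ is the Banach space of all complex sequences $a=(a_n)_{n=0}^\infty$ with $\|a\|_{d_p}:=\big(\sum_{n=0}^\infty\sup_{k\ge n}|a_k|^p\big)^{1/p}<\infty$. The convolution of $a,b\in\mathbb{C}^{\mathbb{N}_0}$ is $(a*b)_n:=\sum_{j=0}^n a_jb_{n-j}$, $n\in\mathbb{N}_0$. The multiplier algebra of $d_p$ is $\mathscr{M}(d_p):=\{b\in\mathbb{C}^{\mathbb{N}_0}: a*b\in d_p \text{ for all } a\in d_p\}$; every such $b$ belongs to $\ell^1$. $\mathscr{L}(d_p)$ is the Banach algebra of bounded linear operators on $d_p$. For $b\in\mathscr{M}(d_p)$, $T_b\in\mathscr{L}(d_p)$ is the (automatically bounded) operator $T_b(a):=a*b$, and $\mathscr{M}_{\mathrm{op}}(d_p):=\{T_b:b\in\mathscr{M}(d_p)\}$,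 a unital commutative Banach algebra with the operator norm $\|\cdot\|_{\mathscr{M}_{\mathrm{op}}(d_p)}$ inherited from $\mathscr{L}(d_p)$. $S$ is the right-shift $S(a_0,a_1,\dots)=(0,a_0,a_1,\dots)$, and $\mathscr{A}(S,d_p)$ is the closure in $\mathscr{M}_{\mathrm{op}}(d_p)$ of the algebra of all polynomials in $S$ (including the constants, i.e. multiples of the identity $I$). For a unital Banach algebra $\mathscr{A}$ and $x\in\mathscr{A}$, $\sigma(x;\mathscr{A})$ denotes the spectrum of $x$ in $\mathscr{A}$. *)

theory Defs
  imports Complex_Main "HOL-Algebra.Module"
begin

(* The boundedness clause says that the suprema are finite; without it a supremum over an
   unbounded set of reals would be an unspecified value. *)
definition d_space :: "real \<Rightarrow> (nat \<Rightarrow> complex) set" where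
  "d_space p = {a. bdd_above (range (\<lambda>k. cmod (a k))) \<and>
                   summable (\<lambda>n. SUP k\<in>{n..}. cmod (a k) powr p)}"

definition d_norm :: "real \<Rightarrow> (nat \<Rightarrow> complex) \<Rightarrow> real" where
  "d_norm p a = (\<Sum>n. SUP k\<in>{n..}. cmod (a k) powr p) powr (1 / p)"

definition conv :: "(nat \<Rightarrow> complex) \<Rightarrow> (nat \<Rightarrow> complex) \<Rightarrow> nat \<Rightarrow> complex" where
  "conv a b = (\<lambda>n. \<Sum>j\<le>n. a j * b (n - j))"

definition multipliers :: "real \<Rightarrow> (nat \<Rightarrow> complex) set" where
  "multipliers p = {b. \<forall>a\<in>d_space p. conv a b \<in> d_space p}"

type_synonym seq_op = "(nat \<Rightarrow> complex) \<Rightarrow> nat \<Rightarrow> complex"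

(* Operators on d_p are extensional functions (undefined off d_p), so that equality of
   operators is equality on d_p. *)
definition bounded_ops :: "real \<Rightarrow> seq_op set" where
  "bounded_ops p = {T \<in> d_space p \<rightarrow>\<^sub>E d_space p.
     (\<forall>a\<in>d_space p. \<forall>b\<in>d_space p. T (\<lambda>n. a n + b n) = (\<lambda>n. T a n + T b n)) \<and>
     (\<forall>c. \<forall>a\<in>d_space p. T (\<lambda>n. c * a n) = (\<lambda>n. c * T a n)) \<and>
     (\<exists>C. \<forall>a\<in>d_space p. d_norm p (T a) \<le> C * d_norm p a)}"

definition op_alg :: "real \<Rightarrow> (complex, seq_op) module" where
  "op_alg p = \<lparr>carrier = bounded_ops p,
     mult = (\<lambda>T U. compose (d_space p) T U),
     one = (\<lambda>a\<in>d_space p. a),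
     zero = (\<lambda>a\<in>d_space p. \<lambda>n. 0),
     add = (\<lambda>T U. \<lambda>a\<in>d_space p. \<lambda>n. T a n + U a n),
     smult = (\<lambda>c T. \<lambda>a\<in>d_space p. \<lambda>n. c * T a n)\<rparr>"

(* Meaningful for T in bounded_ops p only, where the set is bounded above. *)
definition op_norm :: "real \<Rightarrow> seq_op \<Rightarrow> real" where
  "op_norm p T = (SUP a\<in>{a \<in> d_space p. d_norm p a \<le> 1}. d_norm p (T a))"

definition mult_op :: "real \<Rightarrow> (nat \<Rightarrow> complex) \<Rightarrow> seq_op" where
  "mult_op p b = (\<lambda>a\<in>d_space p. conv a b)"

(* The carrier is contained in bounded_ops p because every multiplication operator is
   automatically bounded (closed graph theorem). *)
definition mult_alg :: "real \<Rightarrow> (complex, seq_op) module" where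
  "mult_alg p = (op_alg p)\<lparr>carrier := mult_op p ` multipliers p\<rparr>"

definition shift :: "real \<Rightarrow> seq_op" where
  "shift p = (\<lambda>a\<in>d_space p. \<lambda>n. case n of 0 \<Rightarrow> 0 | Suc m \<Rightarrow> a m)"

definition shift_poly :: "real \<Rightarrow> (nat \<Rightarrow> complex) \<Rightarrow> nat \<Rightarrow> seq_op" where
  "shift_poly p c n =
     (\<Oplus>\<^bsub>op_alg p\<^esub>j\<in>{..n}. c j \<odot>\<^bsub>op_alg p\<^esub> (shift p [^]\<^bsub>op_alg p\<^esub> j))"

definition shift_alg :: "real \<Rightarrow> (complex, seq_op) module" where
  "shift_alg p = (mult_alg p)\<lparr>carrier := {T \<in> carrier (mult_alg p).
     \<forall>e>0. \<exists>c n. op_norm p (T \<ominus>\<^bsub>op_alg p\<^esub> shift_poly p c n) < e}\<rparr>"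

definition spectrum :: "(complex, 'a) module \<Rightarrow> 'a \<Rightarrow> complex set" where
  "spectrum A x = {z. (z \<odot>\<^bsub>A\<^esub> \<one>\<^bsub>A\<^esub>) \<ominus>\<^bsub>A\<^esub> x \<notin> Units A}"

end

theory Submission
  imports Defs "HOL-Complex_Analysis.Complex_Analysis"
begin

text \<open>A multiplier of \<open>d_p\<close> is handled as a formal power series \<open>F\<close>, so that convolution becomes
  multiplication in a commutative ring and \<open>T_F T_G = T_(FG)\<close>.  In each of the three algebras the
  operator \<open>z I - T_b\<close> is \<open>T_F\<close> with \<open>F = z - b\<close>, and the question is where \<open>1 / F\<close> lives.

  The spectra in the multiplier algebra and in all bounded operators agree for an essentially
  algebraic reason: if \<open>U\<close> inverts \<open>T_F\<close> and \<open>G = U(e_0)\<close>, then \<open>F G = 1\<close> and \<open>G a = G F (U a) = U a\<close>, so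
  that \<open>U = T_G\<close> (\<open>Units_op_alg_iff\<close>).  What remains is
  that every multiplier acts boundedly, which is a Baire category argument
  (\<open>multiplier_bounded\<close>).

  Values on the closed disc belong to the spectrum because a multiplier has absolutely summable
  coefficients, with \<open>\<ell>\<^sup>1\<close>-norm at most its operator norm (\<open>mult_bound_l1\<close>): evaluation at a
  point of the disc is then multiplicative, and \<open>b(\<lambda>) - b\<close> vanishes at \<open>\<lambda>\<close>
  (\<open>no_inverse_at_value\<close>).

  The remaining inclusion says that a norm limit \<open>B\<close> of polynomials in the shift which has no zero
  on the closed disc is invertible, with an inverse that is again such a limit
  (\<open>approximable_invertible\<close>).  Gelfand theory would give this from the fact that the shift has
  spectral radius 1; here Newman's elementary argument for Wiener's lemma is used instead.  Write
  \<open>B = Q + R\<close> with a polynomial \<open>Q\<close> and \<open>R\<close> small in norm compared with the minimum \<open>\<delta>\<close> of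
  \<open>|B|\<close> on the disc, and expand \<open>1 / B = \<Sum>k. (- R)^k / Q^(k + 1)\<close>.  The powers of \<open>R\<close> are small in
  norm.  The reciprocal of \<open>Q\<close> extends to a disc of radius \<open>\<rho> > 1\<close> with bound \<open>2 / \<delta>\<close> there, so
  the coefficients of \<open>1 / Q^k\<close> are at most \<open>(2 / \<delta>)^k / \<rho>^j\<close> by Cauchy's inequality.  Since the
  norm of the \<open>j\<close>-th power of the shift grows only polynomially in \<open>j\<close>, the norm of \<open>1 / Q^k\<close> is
  at most a constant times \<open>(2 / \<delta>)^k\<close>, and the series converges.\<close>

section \<open>Reciprocals of polynomials near the closed unit disc\<close>

lemma poly_sums: "(\<lambda>n. coeff Q n * z ^ n) sums poly Q (z :: complex)"
  using sums_eval_fps[of z "fps_of_poly Q"] by simp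

text \<open>Cauchy's inequality on the circle of radius \<open>\<rho>\<close>.  The exponential growth rate in \<open>k\<close> is governed
  by the lower bound of \<open>|Q|\<close> alone, which is what makes a Neumann series in \<open>1 / Q\<close> converge.\<close>

lemma inverse_poly_power_coeff_bound:
  fixes Q :: "complex poly"
  assumes "0 < \<rho>" "0 < c" and Q: "\<And>z. cmod z \<le> \<rho> \<Longrightarrow> c \<le> cmod (poly Q z)"
  shows "cmod (fps_nth (inverse (fps_of_poly Q) ^ k) j) \<le> (1 / c) ^ k / \<rho> ^ j"
proof -
  let ?f = "\<lambda>z. inverse (poly Q z) ^ k"
  have nz: "poly Q z \<noteq> 0" if "cmod z \<le> \<rho>" for z
    using Q[OF that] \<open>0 < c\<close> by auto
  have "eval_fps (fps_of_poly Q) = poly Q"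
    by (simp add: fun_eq_iff)
  then have "poly Q has_fps_expansion fps_of_poly Q"
    using eval_fps_has_fps_expansion[of "fps_of_poly Q"] by simp
  then have "?f has_fps_expansion inverse (fps_of_poly Q) ^ k"
    using nz[of 0] \<open>0 < \<rho>\<close>
    by (intro fps_expansion_intros) (auto simp: poly_0_coeff_0)
  then have "fps_nth (inverse (fps_of_poly Q) ^ k) j = (deriv ^^ j) ?f 0 / fact j"
    by (rule fps_nth_fps_expansion)
  moreover have "cmod ((deriv ^^ j) ?f 0) \<le> fact j * (1 / c) ^ k / \<rho> ^ j"
  proof (rule Cauchy_inequality)
    show "?f holomorphic_on ball 0 \<rho>"
      using nz by (intro holomorphic_intros) auto
    show "continuous_on (cball 0 \<rho>) ?f"
      using nz by (intro continuous_intros) auto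
    show "norm (?f z) \<le> (1 / c) ^ k" if "norm (0 - z) = \<rho>" for z
      using Q[of z] that \<open>0 < c\<close>
      by (auto simp: norm_power norm_inverse divide_inverse intro!: power_mono le_imp_inverse_le)
  qed fact
  ultimately show ?thesis
    by (simp add: norm_divide divide_le_eq mult_ac)
qed

lemma poly_lower_bound_extends:
  fixes Q :: "complex poly"
  assumes "c' < c" and Q: "\<And>z. cmod z \<le> 1 \<Longrightarrow> c \<le> cmod (poly Q z)"
  shows "\<exists>\<rho>>1. \<forall>z. cmod z \<le> \<rho> \<longrightarrow> c' \<le> cmod (poly Q z)"
proof -
  have "uniformly_continuous_on (cball 0 2) (poly Q)"
    by (intro compact_uniformly_continuous continuous_intros) auto
  then have "\<exists>\<eta>>0. \<forall>z\<in>cball 0 2. \<forall>w\<in>cball 0 2. dist w z < \<eta> \<longrightarrow>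
      dist (poly Q w) (poly Q z) < c - c'"
    unfolding uniformly_continuous_on_def by (rule allE[where x = "c - c'"]) (use \<open>c' < c\<close> in simp)
  then obtain \<eta> where \<eta>: "0 < \<eta>" "\<And>z w. z \<in> cball 0 2 \<Longrightarrow> w \<in> cball 0 2 \<Longrightarrow> dist w z < \<eta> \<Longrightarrow>
      dist (poly Q w) (poly Q z) < c - c'"
    by blast
  define \<rho> where "\<rho> = 1 + min 1 (\<eta> / 2)"
  have "c' \<le> cmod (poly Q z)" if z: "cmod z \<le> \<rho>" for z
  proof (cases "cmod z \<le> 1")
    case True
    then show ?thesis using Q[of z] \<open>c' < c\<close> by simp
  next
    case False
    \<comment> \<open>Compare with the radial projection of \<open>z\<close> to the unit circle.\<close>
    let ?w = "sgn z"
    have "z - ?w = of_real (cmod z - 1) * ?w"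
    proof -
      have "z \<noteq> 0"
        using False by auto
      then show ?thesis
        by (simp add: sgn_eq field_simps)
    qed
    then have "cmod (z - ?w) = (cmod z - 1) * cmod ?w"
      using False by (simp add: norm_mult flip: of_real_diff)
    then have "dist ?w z < \<eta>"
      using False z \<eta>(1) by (auto simp: dist_norm norm_minus_commute norm_sgn \<rho>_def split: if_splits)
    then have "dist (poly Q ?w) (poly Q z) < c - c'"
      using z by (intro \<eta>(2)) (auto simp: norm_sgn \<rho>_def)
    moreover have "c \<le> cmod (poly Q ?w)"
      by (intro Q) (simp add: norm_sgn)
    ultimately show ?thesis
      using norm_triangle_ineq2[of "poly Q ?w" "poly Q z"] by (simp add: dist_norm)
  qed
  moreover have "1 < \<rho>"
    using \<eta>(1) by (simp add: \<rho>_def)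
  ultimately show ?thesis
    by blast
qed

section \<open>The norm of \<open>d_p\<close>\<close>

lemma conv_eq_fps: "conv a b = fps_nth (Abs_fps a * Abs_fps b)"
  by (simp add: conv_def fps_mult_nth atLeast0AtMost fun_eq_iff)

locale d_space_exponent =
  fixes p :: real
  assumes p: "1 \<le> p"
begin

text \<open>For positive \<open>u\<close> and \<open>v\<close> this is \<open>powr_convex\<close>; at an endpoint the inequality reduces to
  \<open>s\<^sup>p \<le> s\<close> for \<open>0 \<le> s \<le> 1\<close>.\<close>

lemma convex_powr_nonneg:
  fixes u v t :: real
  assumes "0 \<le> u" "0 \<le> v" "0 \<le> t" "t \<le> 1"
  shows "(t * u + (1 - t) * v) powr p \<le> t * u powr p + (1 - t) * v powr p"
proof -
  have scale: "(s * w) powr p \<le> s * w powr p" if "0 \<le> s" "s \<le> 1" "0 \<le> w" for s w :: real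
  proof -
    have "s powr p \<le> s powr 1"
      using that p by (intro powr_mono') auto
    then show ?thesis
      using that by (simp add: powr_mult mult_right_mono)
  qed
  consider "u = 0" | "v = 0" | "u > 0" "v > 0"
    using assms by linarith
  then show ?thesis
  proof cases
    case 1
    then show ?thesis using scale[of "1 - t" v] assms p by simp
  next
    case 2
    then show ?thesis using scale[of t u] assms p by simp
  next
    case 3
    then show ?thesis
      using convex_onD[OF powr_convex[OF p], of "1 - t" u v] assms by simp
  qed
qed

lemma Minkowski_sum:
  fixes x y :: "'i \<Rightarrow> real"
  assumes "finite I" "\<And>i. 0 \<le> x i" "\<And>i. 0 \<le> y i" "0 \<le> A" "0 \<le> B"
    and x: "(\<Sum>i\<in>I. x i powr p) \<le> A powr p" and y: "(\<Sum>i\<in>I. y i powr p) \<le> B powr p"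
  shows "(\<Sum>i\<in>I. (x i + y i) powr p) \<le> (A + B) powr p"
proof -
  have zero: "f i = 0" if "(\<Sum>i\<in>I. f i powr p) \<le> 0 powr p" "i \<in> I" for f :: "'i \<Rightarrow> real" and i
  proof -
    have "(\<Sum>i\<in>I. f i powr p) = 0"
      using that(1) p by (intro antisym sum_nonneg) auto
    then show ?thesis
      using that(2) \<open>finite I\<close> by (simp add: sum_nonneg_eq_0_iff)
  qed
  consider "A = 0" | "B = 0" | "A > 0" "B > 0"
    using assms by linarith
  then show ?thesis
  proof cases
    case 1
    then show ?thesis using zero[of x] x y by simp
  next
    case 2
    then show ?thesis using zero[of y] x y by simp
  next
    case 3
    \<comment> \<open>Normalise both families and write their sum as a convex combination.\<close>
    define t where "t = A / (A + B)"
    have t: "0 \<le> t" "t \<le> 1" "1 - t = B / (A + B)"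
      using 3 by (auto simp: t_def field_simps)
    have "(x i + y i) powr p
        \<le> (A + B) powr p * (t * (x i / A) powr p + (1 - t) * (y i / B) powr p)" for i
    proof -
      have "x i + y i = (A + B) * (t * (x i / A) + (1 - t) * (y i / B))"
      proof -
        have "t * (x i / A) = x i / (A + B)" "(1 - t) * (y i / B) = y i / (A + B)"
          unfolding t(3) unfolding t_def using 3 by auto
        then show ?thesis
          using 3 by (simp add: add_divide_distrib[symmetric])
      qed
      moreover have "\<dots> powr p = (A + B) powr p * (t * (x i / A) + (1 - t) * (y i / B)) powr p"
        using 3 t(1,2) assms(2,3) by (intro powr_mult)
      moreover have "(t * (x i / A) + (1 - t) * (y i / B)) powr p
          \<le> t * (x i / A) powr p + (1 - t) * (y i / B) powr p"
        using 3 t assms(2,3) by (intro convex_powr_nonneg) auto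
      ultimately show ?thesis
        by (simp add: mult_left_mono)
    qed
    then have "(\<Sum>i\<in>I. (x i + y i) powr p)
        \<le> (\<Sum>i\<in>I. (A + B) powr p * (t * (x i / A) powr p + (1 - t) * (y i / B) powr p))"
      by (intro sum_mono)
    also have "\<dots> = (A + B) powr p *
        (t * ((\<Sum>i\<in>I. x i powr p) / A powr p) + (1 - t) * ((\<Sum>i\<in>I. y i powr p) / B powr p))"
      using 3 assms(2,3)
      by (simp add: sum_distrib_left[symmetric] sum.distrib sum_divide_distrib[symmetric] powr_divide
          flip: times_divide_eq_right)
    also have "\<dots> \<le> (A + B) powr p * (t * 1 + (1 - t) * 1)"
      using 3 t x y by (intro mult_left_mono add_mono) (auto simp: divide_le_eq)
    finally show ?thesis by simp
  qed
qed

lemma d_norm_nonneg [simp]: "0 \<le> d_norm p a"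
  by (simp add: d_norm_def)

text \<open>Replacing each supremum by an arbitrary choice of an index \<open>\<kappa> n \<ge> n\<close> describes the closed balls
  of \<open>d_p\<close> by inequalities between finite sums.  In this form the triangle inequality reduces to
  Minkowski's inequality for finite sums, closed balls are visibly closed under pointwise limits,
  and the action of the shift amounts to a change of \<open>\<kappa>\<close>.\<close>

lemma d_ball_iff:
  assumes "0 \<le> M"
  shows "a \<in> d_space p \<and> d_norm p a \<le> M \<longleftrightarrow>
    (\<forall>N \<kappa>. (\<forall>n. n \<le> \<kappa> n) \<longrightarrow> (\<Sum>n<N. cmod (a (\<kappa> n)) powr p) \<le> M powr p)"
    (is "?L \<longleftrightarrow> ?R")
proof
  define h where "h = (\<lambda>n. SUP k\<in>{n..}. cmod (a k) powr p)"
  have bdd: "bdd_above ((\<lambda>k. cmod (a k) powr p) ` {n..})"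
    if bounded: "bdd_above (range (\<lambda>k. cmod (a k)))" for n
  proof -
    obtain C where "\<And>k. cmod (a k) \<le> C"
      using bounded by (auto simp: bdd_above_def)
    then show ?thesis
      using p by (intro bdd_aboveI2[where M = "C powr p"] powr_mono2) auto
  qed
  {
    assume L: ?L
    then have B: "bdd_above (range (\<lambda>k. cmod (a k)))" and S: "summable h"
      by (auto simp: d_space_def h_def)
    have up: "cmod (a k) powr p \<le> h n" if "n \<le> k" for n k
      unfolding h_def using bdd[OF B] that by (intro cSUP_upper) auto
    have h0: "0 \<le> h n" for n
      using up[of n n] by (meson order_trans powr_ge_zero order_refl)
    show ?R
    proof (intro allI impI)
      fix N and \<kappa> :: "nat \<Rightarrow> nat" assume k: "\<forall>n. n \<le> \<kappa> n"
      have "(\<Sum>n<N. cmod (a (\<kappa> n)) powr p) \<le> (\<Sum>n<N. h n)"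
        using k up by (intro sum_mono) auto
      also have "\<dots> \<le> suminf h"
        using S h0 by (intro sum_le_suminf) auto
      also have "\<dots> = d_norm p a powr p"
        using p h0 S by (simp add: d_norm_def h_def[symmetric] powr_powr suminf_nonneg)
      also have "\<dots> \<le> M powr p"
        using L p by (intro powr_mono2) auto
      finally show "(\<Sum>n<N. cmod (a (\<kappa> n)) powr p) \<le> M powr p" .
    qed
  }
  assume R: ?R
  \<comment> \<open>Choices with \<open>N = 1\<close> bound \<open>a\<close>, so that the suprema are finite.\<close>
  have le_M: "cmod (a k) \<le> M" for k
  proof -
    have "cmod (a k) powr p \<le> M powr p"
      using R[rule_format, of "\<lambda>n. n + k" 1] by simp
    then show ?thesis
      using p assms by (meson powr_less_mono2 norm_ge_zero not_le order_less_le_trans zero_less_one)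
  qed
  then have B: "bdd_above (range (\<lambda>k. cmod (a k)))"
    by (intro bdd_aboveI2)
  have h0: "0 \<le> h n" for n
    unfolding h_def using bdd[OF B] by (intro cSUP_upper2) auto
  have sum_le: "(\<Sum>n<N. h n) \<le> M powr p" for N
  proof (rule field_le_epsilon)
    fix e :: real assume "0 < e"
    have "\<exists>k\<ge>n. h n - e / (N + 1) < cmod (a k) powr p" for n
    proof -
      have "h n - e / (N + 1) < h n"
        using \<open>0 < e\<close> by simp
      then show ?thesis
        unfolding h_def using bdd[OF B, of n] by (subst (asm) less_cSUP_iff) (auto simp: h_def)
    qed
    then obtain \<kappa> where k: "\<And>n. n \<le> \<kappa> n" "\<And>n. h n - e / (N + 1) < cmod (a (\<kappa> n)) powr p"
      by metis
    have "(\<Sum>n<N. h n) \<le> (\<Sum>n<N. cmod (a (\<kappa> n)) powr p + e / (N + 1))"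
      using k(2) by (intro sum_mono) (simp add: less_imp_le less_diff_eq diff_less_eq)
    also have "\<dots> = (\<Sum>n<N. cmod (a (\<kappa> n)) powr p) + N * e / (N + 1)"
      by (simp add: sum.distrib)
    also have "\<dots> \<le> M powr p + e"
      using R k(1) \<open>0 < e\<close> by (intro add_mono) (auto simp: field_simps)
    finally show "(\<Sum>n<N. h n) \<le> M powr p + e" .
  qed
  have S: "summable h"
    using sum_le h0 by (intro summableI_nonneg_bounded)
  have "suminf h \<le> M powr p"
    using S sum_le by (intro suminf_le_const)
  then have "d_norm p a \<le> (M powr p) powr (1 / p)"
    unfolding d_norm_def h_def[symmetric] using p S h0 by (intro powr_mono2 suminf_nonneg) auto
  then show ?L
    using B S assms p by (simp add: d_space_def h_def[symmetric] powr_powr)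
qed

lemma d_ballI:
  assumes "0 \<le> M"
    and "\<And>N \<kappa>. (\<And>n. n \<le> \<kappa> n) \<Longrightarrow> (\<Sum>n<N. cmod (a (\<kappa> n)) powr p) \<le> M powr p"
  shows "a \<in> d_space p" "d_norm p a \<le> M"
  using assms d_ball_iff[OF assms(1), of a] by auto

lemma d_ballD:
  assumes "a \<in> d_space p" "d_norm p a \<le> M" "\<And>n. n \<le> \<kappa> n"
  shows "(\<Sum>n<N. cmod (a (\<kappa> n)) powr p) \<le> M powr p"
  using assms d_ball_iff[of M a] order_trans[OF d_norm_nonneg assms(2)] by auto

lemma d_space_zero [simp]: "(\<lambda>n. 0) \<in> d_space p"
  and d_norm_zero [simp]: "d_norm p (\<lambda>n. 0) = 0"
  using d_ballI[of 0 "\<lambda>n. 0"] p by (auto intro: antisym)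

lemma d_space_add:
  assumes "a \<in> d_space p" "b \<in> d_space p"
  shows "(\<lambda>n. a n + b n) \<in> d_space p" (is ?mem)
    and "d_norm p (\<lambda>n. a n + b n) \<le> d_norm p a + d_norm p b" (is ?le)
proof -
  have "(\<Sum>n<N. cmod (a (\<kappa> n) + b (\<kappa> n)) powr p) \<le> (d_norm p a + d_norm p b) powr p"
    if "\<And>n. n \<le> \<kappa> n" for N \<kappa>
  proof -
    have "(\<Sum>n<N. cmod (a (\<kappa> n) + b (\<kappa> n)) powr p)
        \<le> (\<Sum>n<N. (cmod (a (\<kappa> n)) + cmod (b (\<kappa> n))) powr p)"
      using p by (intro sum_mono powr_mono2 norm_triangle_ineq) auto
    also have "\<dots> \<le> (d_norm p a + d_norm p b) powr p"
      using assms that by (intro Minkowski_sum d_ballD) auto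
    finally show ?thesis .
  qed
  then show ?mem ?le
    using d_ballI[of "d_norm p a + d_norm p b" "\<lambda>n. a n + b n"] by auto
qed

lemma d_space_cmult:
  assumes "a \<in> d_space p"
  shows "(\<lambda>n. c * a n) \<in> d_space p" (is ?mem)
    and "d_norm p (\<lambda>n. c * a n) \<le> cmod c * d_norm p a" (is ?le)
proof -
  have "(\<Sum>n<N. cmod (c * a (\<kappa> n)) powr p) \<le> (cmod c * d_norm p a) powr p"
    if "\<And>n. n \<le> \<kappa> n" for N \<kappa>
    using d_ballD[OF assms order_refl that, of N]
    by (simp add: norm_mult powr_mult sum_distrib_left[symmetric] mult_left_mono)
  from d_ballI[OF _ this] show ?mem ?le by auto
qed

lemma d_norm_cmult:
  assumes "a \<in> d_space p"
  shows "d_norm p (\<lambda>n. c * a n) = cmod c * d_norm p a"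
proof (cases "c = 0")
  case False
  have "d_norm p (\<lambda>n. inverse c * (c * a n)) \<le> cmod (inverse c) * d_norm p (\<lambda>n. c * a n)"
    using assms by (intro d_space_cmult)
  then have "cmod c * d_norm p a \<le> d_norm p (\<lambda>n. c * a n)"
    using False by (simp add: field_simps norm_divide flip: mult.assoc)
  then show ?thesis
    using d_space_cmult(2)[OF assms, of c] by simp
qed simp

lemma d_space_diff:
  assumes "a \<in> d_space p" "b \<in> d_space p"
  shows "(\<lambda>n. a n - b n) \<in> d_space p"
    and "d_norm p (\<lambda>n. a n - b n) \<le> d_norm p a + d_norm p b"
  using d_space_add[OF assms(1) d_space_cmult(1)[OF assms(2), of "- 1"]]
    d_norm_cmult[OF assms(2), of "- 1"] by auto

lemma norm_le_d_norm:
  assumes "a \<in> d_space p"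
  shows "cmod (a k) \<le> d_norm p a"
proof -
  have "cmod (a k) powr p \<le> d_norm p a powr p"
    using d_ballD[OF assms order_refl, of "\<lambda>n. n + k" 1] by simp
  then show ?thesis
    using p by (meson powr_less_mono2 d_norm_nonneg not_le order_less_le_trans zero_less_one)
qed

text \<open>The Fatou property of the norm.  It carries completeness of \<open>d_p\<close>, the closed sets of the Baire
  argument, and every limit of multipliers below.\<close>

lemma d_ball_closed_pointwise:
  assumes lim: "\<And>k. (\<lambda>m. u m k) \<longlonglongrightarrow> a k"
    and ev: "\<forall>\<^sub>F m in sequentially. u m \<in> d_space p \<and> d_norm p (u m) \<le> M"
  shows "a \<in> d_space p" "d_norm p a \<le> M"
proof -
  have "0 \<le> M"
    using eventually_happens[OF ev] by (auto intro: order_trans[OF d_norm_nonneg])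
  moreover have "(\<Sum>n<N. cmod (a (\<kappa> n)) powr p) \<le> M powr p" if "\<And>n. n \<le> \<kappa> n" for N \<kappa>
  proof (rule tendsto_upperbound)
    show "(\<lambda>m. \<Sum>n<N. cmod (u m (\<kappa> n)) powr p) \<longlonglongrightarrow> (\<Sum>n<N. cmod (a (\<kappa> n)) powr p)"
      using p by (intro tendsto_intros lim tendsto_powr') auto
    show "\<forall>\<^sub>F m in sequentially. (\<Sum>n<N. cmod (u m (\<kappa> n)) powr p) \<le> M powr p"
      using ev by eventually_elim (use that in \<open>auto intro: d_ballD\<close>)
  qed auto
  ultimately show "a \<in> d_space p" "d_norm p a \<le> M"
    using d_ballI by auto
qed

text \<open>The norm of a sequence of moduli at most 1 supported on \<open>{0..N}\<close>: only the first \<open>N + 1\<close>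
  suprema can be nonzero.\<close>

lemma d_space_indicator:
  assumes "\<And>j. cmod (a j) \<le> (if j \<le> N then 1 else 0)"
  shows "a \<in> d_space p" "d_norm p a \<le> (real N + 1) powr (1 / p)"
proof -
  let ?r = "(real N + 1) powr (1 / p)"
  have "(\<Sum>n<M. cmod (a (\<kappa> n)) powr p) \<le> ?r powr p" if \<kappa>: "\<And>n. n \<le> \<kappa> n" for M \<kappa>
  proof -
    have "(\<Sum>n<M. cmod (a (\<kappa> n)) powr p) \<le> (\<Sum>n<M. if n \<le> N then 1 else 0)"
    proof (rule sum_mono)
      fix n
      have "cmod (a (\<kappa> n)) \<le> (if n \<le> N then 1 else 0)"
        using assms[of "\<kappa> n"] \<kappa>[of n] by (auto split: if_splits)
      then show "cmod (a (\<kappa> n)) powr p \<le> (if n \<le> N then 1 else 0)"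
        using p by (auto intro: powr_le1 split: if_splits)
    qed
    also have "\<dots> = real (card ({..<M} \<inter> {..N}))"
      by (simp add: sum.If_cases atMost_def)
    also have "\<dots> \<le> real (card {..N})"
      by (intro of_nat_mono card_mono) auto
    finally show ?thesis
      using p by (simp add: powr_powr)
  qed
  then show "a \<in> d_space p" "d_norm p a \<le> ?r"
    using d_ballI[of ?r a] by auto
qed

lemma fps_one_in_d_space: "fps_nth 1 \<in> d_space p"
  by (rule d_space_indicator[of _ 0]) auto

section \<open>Power series acting on \<open>d_p\<close> by convolution\<close>

text \<open>An upper bound, rather than the operator norm itself, because bounds combine under sums,
  products and limits without any supremum having to be known to exist.\<close>

definition mult_bound :: "complex fps \<Rightarrow> real \<Rightarrow> bool" where
  "mult_bound F K \<longleftrightarrow> (\<forall>a\<in>d_space p. fps_nth (F * Abs_fps a) \<in> d_space p \<and>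
     d_norm p (fps_nth (F * Abs_fps a)) \<le> K * d_norm p a)"

lemma mult_boundI:
  assumes "\<And>a. a \<in> d_space p \<Longrightarrow> fps_nth (F * Abs_fps a) \<in> d_space p"
    and "\<And>a. a \<in> d_space p \<Longrightarrow> d_norm p (fps_nth (F * Abs_fps a)) \<le> K * d_norm p a"
  shows "mult_bound F K"
  using assms by (simp add: mult_bound_def)

lemma mult_boundD:
  assumes "mult_bound F K" "a \<in> d_space p"
  shows "fps_nth (F * Abs_fps a) \<in> d_space p" "d_norm p (fps_nth (F * Abs_fps a)) \<le> K * d_norm p a"
  using assms by (simp_all add: mult_bound_def)

lemma mult_bound_mono: "mult_bound F K \<Longrightarrow> K \<le> L \<Longrightarrow> mult_bound F L"
  by (meson mult_boundD mult_boundI d_norm_nonneg mult_right_mono order_trans)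

lemma mult_bound_add:
  assumes F: "mult_bound F K" and G: "mult_bound G L"
  shows "mult_bound (F + G) (K + L)"
proof (rule mult_boundI)
  fix a assume a: "a \<in> d_space p"
  have "fps_nth ((F + G) * Abs_fps a) = (\<lambda>n. fps_nth (F * Abs_fps a) n + fps_nth (G * Abs_fps a) n)"
    by (simp add: fun_eq_iff distrib_right)
  then show "fps_nth ((F + G) * Abs_fps a) \<in> d_space p"
    "d_norm p (fps_nth ((F + G) * Abs_fps a)) \<le> (K + L) * d_norm p a"
    using d_space_add[OF mult_boundD(1)[OF F a] mult_boundD(1)[OF G a]]
      mult_boundD(2)[OF F a] mult_boundD(2)[OF G a] by (auto simp: distrib_right)
qed

lemma mult_bound_mult:
  assumes F: "mult_bound F K" and G: "mult_bound G L" and "0 \<le> K"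
  shows "mult_bound (F * G) (K * L)"
proof (rule mult_boundI)
  fix a assume a: "a \<in> d_space p"
  let ?c = "fps_nth (G * Abs_fps a)"
  have c: "?c \<in> d_space p" "K * d_norm p ?c \<le> K * (L * d_norm p a)"
    using mult_boundD[OF G a] \<open>0 \<le> K\<close> by (auto intro: mult_left_mono)
  have "fps_nth (F * G * Abs_fps a) = fps_nth (F * Abs_fps ?c)"
    by (simp add: mult.assoc fps_nth_inverse)
  then show "fps_nth (F * G * Abs_fps a) \<in> d_space p"
    "d_norm p (fps_nth (F * G * Abs_fps a)) \<le> K * L * d_norm p a"
    using mult_boundD[OF F c(1)] c(2) by (auto simp: mult.assoc)
qed

lemma mult_bound_const: "mult_bound (fps_const c) (cmod c)"
proof (rule mult_boundI)
  fix a assume a: "a \<in> d_space p"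
  have "fps_nth (fps_const c * Abs_fps a) = (\<lambda>n. c * a n)"
    by (simp add: fun_eq_iff)
  then show "fps_nth (fps_const c * Abs_fps a) \<in> d_space p"
    "d_norm p (fps_nth (fps_const c * Abs_fps a)) \<le> cmod c * d_norm p a"
    using d_space_cmult[OF a, of c] by auto
qed

lemma mult_bound_1: "mult_bound 1 1"
  using mult_bound_const[of 1] by simp

lemma mult_bound_0: "mult_bound 0 0"
  using mult_bound_const[of 0] by simp

lemma mult_bound_cmult:
  "mult_bound F K \<Longrightarrow> mult_bound (fps_const c * F) (cmod c * K)"
  by (rule mult_bound_mult[OF mult_bound_const]) auto

lemma mult_bound_uminus: "mult_bound F K \<Longrightarrow> mult_bound (- F) K"
  using mult_bound_cmult[of F K "- 1"] by (simp flip: fps_const_neg)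

lemma mult_bound_diff:
  "mult_bound F K \<Longrightarrow> mult_bound G L \<Longrightarrow> mult_bound (F - G) (K + L)"
  using mult_bound_add[OF _ mult_bound_uminus] by fastforce

lemma mult_bound_sum:
  assumes "finite I" "\<And>i. i \<in> I \<Longrightarrow> mult_bound (F i) (K i)"
  shows "mult_bound (\<Sum>i\<in>I. F i) (\<Sum>i\<in>I. K i)"
  using assms by (induction I rule: finite_induct) (auto intro: mult_bound_0 mult_bound_add)

lemma mult_bound_power:
  assumes "mult_bound F K" "0 \<le> K"
  shows "mult_bound (F ^ k) (K ^ k)"
  using assms by (induction k) (auto intro: mult_bound_1 mult_bound_mult)

text \<open>The Fatou property of the norm of \<open>d_p\<close>, passed on to operator norms.\<close>

lemma mult_bound_lim:
  assumes lim: "\<And>k. (\<lambda>m. fps_nth (U m) k) \<longlonglongrightarrow> fps_nth F k"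
    and ev: "\<forall>\<^sub>F m in sequentially. mult_bound (U m) K"
  shows "mult_bound F K"
proof (rule mult_boundI)
  fix a assume a: "a \<in> d_space p"
  have "(\<lambda>m. fps_nth (U m * Abs_fps a) k) \<longlonglongrightarrow> fps_nth (F * Abs_fps a) k" for k
    unfolding fps_mult_nth by (intro tendsto_intros lim)
  moreover have "\<forall>\<^sub>F m in sequentially. fps_nth (U m * Abs_fps a) \<in> d_space p \<and>
      d_norm p (fps_nth (U m * Abs_fps a)) \<le> K * d_norm p a"
    using ev by eventually_elim (use mult_boundD a in auto)
  ultimately show "fps_nth (F * Abs_fps a) \<in> d_space p"
    "d_norm p (fps_nth (F * Abs_fps a)) \<le> K * d_norm p a"
    by (rule d_ball_closed_pointwise)+
qed

text \<open>Shifting by \<open>j\<close> places repeats the largest supremum \<open>j\<close> times, so the \<open>p\<close>-th power of the norm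
  grows at most by the factor \<open>j + 1\<close>.  Growth that is only polynomial in \<open>j\<close> means that the
  spectral radius of the shift is at most 1.\<close>

lemma mult_bound_X_power: "mult_bound (fps_X ^ j) (real j + 1)"
proof (rule mult_boundI)
  fix a assume a: "a \<in> d_space p"
  let ?M = "d_norm p a"
  let ?g = "\<lambda>k. cmod (fps_nth (fps_X ^ j * Abs_fps a) k) powr p"
  have "(\<Sum>n<N. ?g (\<kappa> n)) \<le> ((real j + 1) * ?M) powr p" if \<kappa>: "\<And>n. n \<le> \<kappa> n" for N \<kappa>
  proof -
    have "(\<Sum>n<N. ?g (\<kappa> n)) \<le> (\<Sum>n<N + j. ?g (\<kappa> n))"
      by (intro sum_mono2) auto
    also have "\<dots> = (\<Sum>n<j. ?g (\<kappa> n)) + (\<Sum>m<N. ?g (\<kappa> (m + j)))"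
      by (induction N) auto
    also have "(\<Sum>n<j. ?g (\<kappa> n)) \<le> (\<Sum>n<j. ?M powr p)"
      using a p by (intro sum_mono powr_mono2) (auto simp: fps_X_power_mult_nth norm_le_d_norm)
    also have "(\<Sum>m<N. ?g (\<kappa> (m + j))) = (\<Sum>m<N. cmod (a (\<kappa> (m + j) - j)) powr p)"
    proof (intro sum.cong refl)
      show "?g (\<kappa> (m + j)) = cmod (a (\<kappa> (m + j) - j)) powr p" for m
        using \<kappa>[of "m + j"] by (simp add: fps_X_power_mult_nth)
    qed
    also have "\<dots> \<le> ?M powr p"
    proof (rule d_ballD[OF a order_refl])
      show "n \<le> \<kappa> (n + j) - j" for n
        using \<kappa>[of "n + j"] by linarith
    qed
    also have "(\<Sum>n<j. ?M powr p) + ?M powr p = (real j + 1) * ?M powr p"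
      by (simp add: algebra_simps)
    also have "\<dots> \<le> (real j + 1) powr p * ?M powr p"
      using p powr_mono[of 1 p "real j + 1"] by (intro mult_right_mono) auto
    finally show ?thesis
      by (simp add: powr_mult)
  qed
  then show "fps_nth (fps_X ^ j * Abs_fps a) \<in> d_space p"
    "d_norm p (fps_nth (fps_X ^ j * Abs_fps a)) \<le> (real j + 1) * ?M"
    using d_ballI[of "(real j + 1) * ?M" "fps_nth (fps_X ^ j * Abs_fps a)"] by auto
qed

lemma mult_bound_abs_summable:
  assumes "summable (\<lambda>j. cmod (fps_nth F j) * (real j + 1))"
  shows "mult_bound F (\<Sum>j. cmod (fps_nth F j) * (real j + 1))"
proof (rule mult_bound_lim)
  let ?U = "\<lambda>m. \<Sum>j<m. fps_const (fps_nth F j) * fps_X ^ j"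
  show "(\<lambda>m. fps_nth (?U m) k) \<longlonglongrightarrow> fps_nth F k" for k
  proof (rule tendsto_eventually)
    show "\<forall>\<^sub>F m in sequentially. fps_nth (?U m) k = fps_nth F k"
      using eventually_gt_at_top[of k]
      by eventually_elim (simp add: fps_sum_nth if_distrib cong: if_cong)
  qed
  have "mult_bound (?U m) (\<Sum>j<m. cmod (fps_nth F j) * (real j + 1))" for m
    by (intro mult_bound_sum mult_bound_cmult mult_bound_X_power) auto
  then have "mult_bound (?U m) (\<Sum>j. cmod (fps_nth F j) * (real j + 1))" for m
    by (rule mult_bound_mono) (use assms in \<open>auto intro!: sum_le_suminf\<close>)
  then show "\<forall>\<^sub>F m in sequentially.
      mult_bound (?U m) (\<Sum>j. cmod (fps_nth F j) * (real j + 1))"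
    by simp
qed

lemma mult_bound_poly: "\<exists>K\<ge>0. mult_bound (fps_of_poly Q) K"
proof -
  have s: "summable (\<lambda>j. cmod (fps_nth (fps_of_poly Q) j) * (real j + 1))"
    by (rule summable_finite[of "{..degree Q}"]) (auto simp: coeff_eq_0)
  show ?thesis
    using mult_bound_abs_summable[OF s] suminf_nonneg[OF s] by auto
qed

section \<open>Completeness of \<open>d_p\<close> and automatic boundedness of multipliers\<close>

lemma d_metric: "Metric_space (d_space p) (\<lambda>a b. d_norm p (\<lambda>n. a n - b n))"
proof
  fix a b c :: "nat \<Rightarrow> complex"
  show "0 \<le> d_norm p (\<lambda>n. a n - b n)"
    by simp
  show "d_norm p (\<lambda>n. a n - b n) = d_norm p (\<lambda>n. b n - a n)"
    by (simp add: d_norm_def norm_minus_commute)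
  assume a: "a \<in> d_space p" and b: "b \<in> d_space p"
  show "d_norm p (\<lambda>n. a n - b n) = 0 \<longleftrightarrow> a = b"
  proof
    assume "d_norm p (\<lambda>n. a n - b n) = 0"
    then have "cmod (a n - b n) \<le> 0" for n
      using norm_le_d_norm[OF d_space_diff(1)[OF a b], of n] by simp
    then show "a = b"
      by (simp add: fun_eq_iff)
  qed simp
  assume c: "c \<in> d_space p"
  show "d_norm p (\<lambda>n. a n - c n) \<le> d_norm p (\<lambda>n. a n - b n) + d_norm p (\<lambda>n. b n - c n)"
    using d_space_add(2)[OF d_space_diff(1)[OF a b] d_space_diff(1)[OF b c]] by simp
qed

sublocale d: Metric_space "d_space p" "\<lambda>a b. d_norm p (\<lambda>n. a n - b n)"
  by (rule d_metric)

text \<open>A Cauchy sequence converges pointwise, and the Fatou property upgrades this to convergence in norm.\<close>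

lemma d_mcomplete: "d.mcomplete"
  unfolding d.mcomplete_def
proof (intro allI impI)
  fix \<sigma> assume C: "d.MCauchy \<sigma>"
  then have \<sigma>: "\<sigma> n \<in> d_space p" for n
    by (auto simp: d.MCauchy_def)
  have cau: "\<exists>N. \<forall>n n'. N \<le> n \<longrightarrow> N \<le> n' \<longrightarrow> d_norm p (\<lambda>k. \<sigma> n k - \<sigma> n' k) < e" if "0 < e" for e
    using C that by (auto simp: d.MCauchy_def)
  have "Cauchy (\<lambda>n. \<sigma> n k)" for k
  proof (rule metric_CauchyI)
    fix e :: real assume "0 < e"
    with cau obtain N where N: "\<And>n n'. N \<le> n \<Longrightarrow> N \<le> n' \<Longrightarrow> d_norm p (\<lambda>k. \<sigma> n k - \<sigma> n' k) < e"
      by blast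
    have "dist (\<sigma> m k) (\<sigma> n k) < e" if "N \<le> m" "N \<le> n" for m n
      using norm_le_d_norm[OF d_space_diff(1)[OF \<sigma>[of m] \<sigma>[of n]], of k] N[OF that]
      by (simp add: dist_norm)
    then show "\<exists>M. \<forall>m\<ge>M. \<forall>n\<ge>M. dist (\<sigma> m k) (\<sigma> n k) < e"
      by blast
  qed
  then have "\<forall>k. \<exists>l. (\<lambda>n. \<sigma> n k) \<longlonglongrightarrow> l"
    using Cauchy_convergent_iff convergent_def by blast
  then obtain u where u: "\<And>k. (\<lambda>n. \<sigma> n k) \<longlonglongrightarrow> u k"
    by metis
  have close: "\<exists>N. \<forall>n\<ge>N. (\<lambda>k. \<sigma> n k - u k) \<in> d_space p \<and> d_norm p (\<lambda>k. \<sigma> n k - u k) \<le> e"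
    if "0 < e" for e
  proof -
    obtain N where N: "\<And>n n'. N \<le> n \<Longrightarrow> N \<le> n' \<Longrightarrow> d_norm p (\<lambda>k. \<sigma> n k - \<sigma> n' k) < e"
      using cau \<open>0 < e\<close> by blast
    have "(\<lambda>k. \<sigma> n k - u k) \<in> d_space p \<and> d_norm p (\<lambda>k. \<sigma> n k - u k) \<le> e" if "N \<le> n" for n
    proof -
      have lim: "(\<lambda>m. \<sigma> n k - \<sigma> m k) \<longlonglongrightarrow> \<sigma> n k - u k" for k
        by (intro tendsto_intros u)
      have "\<forall>\<^sub>F m in sequentially. (\<lambda>k. \<sigma> n k - \<sigma> m k) \<in> d_space p \<and>
          d_norm p (\<lambda>k. \<sigma> n k - \<sigma> m k) \<le> e"
        using eventually_ge_at_top[of N]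
        by eventually_elim (use N[OF that] \<sigma> in \<open>auto intro: d_space_diff less_imp_le\<close>)
      then show ?thesis
        using d_ball_closed_pointwise[where u = "\<lambda>m k. \<sigma> n k - \<sigma> m k", OF lim] by blast
    qed
    then show ?thesis
      by blast
  qed
  obtain n where "(\<lambda>k. \<sigma> n k - u k) \<in> d_space p"
    using close[of 1] by auto
  then have "u \<in> d_space p"
    using d_space_diff(1)[OF \<sigma>[of n]] by force
  moreover have "\<exists>N. \<forall>n\<ge>N. d_norm p (\<lambda>k. \<sigma> n k - u k) < e" if "0 < e" for e
  proof -
    have "\<exists>N. \<forall>n\<ge>N. d_norm p (\<lambda>k. \<sigma> n k - u k) \<le> e / 2"
      using close[of "e / 2"] \<open>0 < e\<close> half_gt_zero by blast
    moreover have "e / 2 < e"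
      using \<open>0 < e\<close> by simp
    ultimately show ?thesis
      by (meson order_le_less_trans)
  qed
  ultimately have "limitin d.mtopology \<sigma> u sequentially"
    unfolding d.limit_metric_sequentially using \<sigma> by simp
  then show "\<exists>u. limitin d.mtopology \<sigma> u sequentially"
    by (rule exI[of _ u])
qed

text \<open>A uniform boundedness argument: \<open>d_p\<close> is the union of the closed sets on which \<open>F a\<close> has norm at
  most \<open>m\<close>, so one of them contains a ball, and differences of its elements fill a ball around zero.\<close>

lemma multiplier_bounded:
  assumes mem: "\<And>a. a \<in> d_space p \<Longrightarrow> fps_nth (F * Abs_fps a) \<in> d_space p"
  shows "\<exists>K\<ge>0. mult_bound F K"
proof -
  define L where "L m = {a \<in> d_space p. d_norm p (fps_nth (F * Abs_fps a)) \<le> real m}" for m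
  have closed: "closedin d.mtopology (L m)" for m
    unfolding d.metric_closedin_iff_sequentially_closed
  proof (intro conjI allI impI)
    show "L m \<subseteq> d_space p"
      by (auto simp: L_def)
    fix \<sigma> l assume *: "range \<sigma> \<subseteq> L m \<and> limitin d.mtopology \<sigma> l sequentially"
    then have \<sigma>: "\<sigma> n \<in> d_space p" "d_norm p (fps_nth (F * Abs_fps (\<sigma> n))) \<le> real m" for n
      by (auto simp: L_def)
    have l: "l \<in> d_space p"
      using * by (auto simp: d.limit_metric_sequentially)
    have "(\<lambda>n. \<sigma> n k) \<longlonglongrightarrow> l k" for k
    proof (rule metric_LIMSEQ_I)
      fix e :: real assume "0 < e"
      then have "\<exists>N. \<forall>n\<ge>N. d_norm p (\<lambda>k. \<sigma> n k - l k) < e"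
        using * unfolding d.limit_metric_sequentially by meson
      moreover have "dist (\<sigma> n k) (l k) \<le> d_norm p (\<lambda>k. \<sigma> n k - l k)" for n
        using norm_le_d_norm[OF d_space_diff(1)[OF \<sigma>(1)[of n] l], of k] by (simp add: dist_norm)
      ultimately show "\<exists>N. \<forall>n\<ge>N. dist (\<sigma> n k) (l k) < e"
        by (meson order_le_less_trans)
    qed
    then have "(\<lambda>n. fps_nth (F * Abs_fps (\<sigma> n)) k) \<longlonglongrightarrow> fps_nth (F * Abs_fps l) k" for k
      by (auto simp: fps_mult_nth intro!: tendsto_intros)
    then have "d_norm p (fps_nth (F * Abs_fps l)) \<le> real m"
      by (rule d_ball_closed_pointwise) (use \<sigma> mem in auto)
    with l show "l \<in> L m"
      by (simp add: L_def)
  qed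
  \<comment> \<open>The sets \<open>L m\<close> cover the complete space \<open>d_p\<close>.\<close>
  have "\<exists>m. d.mtopology interior_of L m \<noteq> {}"
  proof (rule ccontr)
    assume "\<nexists>m. d.mtopology interior_of L m \<noteq> {}"
    then have "d.mtopology interior_of \<Union>(range L) = {}"
      using closed by (intro d.metric_Baire_category_alt d_mcomplete) auto
    moreover have "\<Union>(range L) = topspace d.mtopology"
      using real_arch_simple by (force simp: L_def)
    ultimately have "d_space p = {}"
      using interior_of_topspace[of d.mtopology] by simp
    then show False
      using d_space_zero by blast
  qed
  then obtain m x where "x \<in> d.mtopology interior_of L m"
    by blast
  then obtain r where r: "0 < r" "d.mball x r \<subseteq> L m" and x: "x \<in> d_space p"
    using openin_interior_of[of d.mtopology "L m"] interior_of_subset[of d.mtopology "L m"]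
    unfolding d.openin_mtopology by (meson dual_order.trans subsetD)
  have "x \<in> L m"
    using r x by auto
  have small: "d_norm p (fps_nth (F * Abs_fps a)) \<le> 2 * real m"
    if a: "a \<in> d_space p" "d_norm p a < r" for a
  proof -
    have "(\<lambda>n. x n + a n) \<in> d.mball x r"
      using x a d_space_add[OF x a(1)] d_norm_cmult[OF a(1), of "- 1"] by simp
    then have "(\<lambda>n. x n + a n) \<in> L m"
      using r by blast
    moreover have "fps_nth (F * Abs_fps a) = (\<lambda>k. fps_nth (F * Abs_fps (\<lambda>n. x n + a n)) k
        - fps_nth (F * Abs_fps x) k)"
      by (simp add: fun_eq_iff fps_mult_nth distrib_left sum.distrib)
    ultimately show ?thesis
      using d_space_diff(2)[OF mem mem, of "\<lambda>n. x n + a n" x] \<open>x \<in> L m\<close> by (simp add: L_def)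
  qed
  have "mult_bound F (4 * real m / r)"
  proof (rule mult_boundI)
    fix a assume a: "a \<in> d_space p"
    then show "fps_nth (F * Abs_fps a) \<in> d_space p"
      by (rule mem)
    show "d_norm p (fps_nth (F * Abs_fps a)) \<le> 4 * real m / r * d_norm p a"
    proof (cases "d_norm p a = 0")
      case True
      then have "a n = 0" for n
        using norm_le_d_norm[OF a, of n] by simp
      then have "fps_nth (F * Abs_fps a) = (\<lambda>n. 0)"
        by (simp add: fun_eq_iff fps_mult_nth)
      then show ?thesis
        using True by simp
    next
      case False
      then have pos: "0 < d_norm p a"
        using d_norm_nonneg[of a] by linarith
      define t where "t = r / (2 * d_norm p a)"
      have t: "0 < t"
        using pos r by (simp add: t_def)
      have "d_norm p (\<lambda>n. of_real t * a n) < r"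
        using d_norm_cmult[OF a, of "of_real t"] t pos r by (simp, simp add: t_def)
      then have "d_norm p (fps_nth (F * Abs_fps (\<lambda>n. of_real t * a n))) \<le> 2 * real m"
        by (intro small d_space_cmult a)
      moreover have "fps_nth (F * Abs_fps (\<lambda>n. of_real t * a n))
          = (\<lambda>n. of_real t * fps_nth (F * Abs_fps a) n)"
        by (simp add: fun_eq_iff fps_mult_nth sum_distrib_left mult_ac)
      ultimately have "t * d_norm p (fps_nth (F * Abs_fps a)) \<le> 2 * real m"
        using d_norm_cmult[OF mem[OF a], of "of_real t"] t by simp
      then show ?thesis
        using pos r by (simp add: t_def field_simps)
    qed
  qed
  then show ?thesis
    using r by (intro exI[of _ "4 * real m / r"]) auto
qed

section \<open>Values of a multiplier on the closed unit disc\<close>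

text \<open>Test \<open>F\<close> on the sequence \<open>a\<close> of length \<open>N + 1\<close> whose phases make the \<open>N\<close>-th coefficient of
  \<open>F a\<close> equal to \<open>\<Sum>j\<le>N. |F_j|\<close>.  That coefficient bounds the first \<open>N + 1\<close> suprema of \<open>F a\<close> from
  below, so both norms carry the same factor \<open>(N + 1)\<^sup>1\<^sup>/\<^sup>p\<close>.\<close>

lemma mult_bound_l1:
  assumes F: "mult_bound F K"
  shows "(\<Sum>j\<le>N. cmod (fps_nth F j)) \<le> K"
proof -
  define a where "a j = (if j \<le> N then cnj (sgn (fps_nth F (N - j))) else 0)" for j
  let ?r = "(real N + 1) powr (1 / p)"
  have r: "?r powr p = real N + 1" "0 < ?r"
    using p by (simp_all add: powr_powr)
  have a: "a \<in> d_space p" "d_norm p a \<le> ?r"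
    using d_space_indicator[of a N] by (simp_all add: a_def norm_sgn)
  let ?S = "\<Sum>j\<le>N. cmod (fps_nth F j)"
  have "fps_nth (F * Abs_fps a) N = (\<Sum>j\<le>N. of_real (cmod (fps_nth F j)))"
    unfolding fps_mult_nth atLeast0AtMost
  proof (rule sum.cong)
    fix j assume "j \<in> {..N}"
    then show "fps_nth F j * fps_nth (Abs_fps a) (N - j) = of_real (cmod (fps_nth F j))"
      by (cases "fps_nth F j = 0") (auto simp: a_def sgn_eq complex_norm_square[symmetric]
          power2_eq_square)
  qed simp
  then have val: "cmod (fps_nth (F * Abs_fps a) N) = ?S"
    by (simp flip: of_real_sum add: sum_nonneg)
  \<comment> \<open>The choice \<open>max n N\<close> selects the \<open>N\<close>-th coefficient in each of the first \<open>N + 1\<close> suprema.\<close>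
  have "(\<Sum>n<Suc N. cmod (fps_nth (F * Abs_fps a) (max n N)) powr p)
      \<le> d_norm p (fps_nth (F * Abs_fps a)) powr p"
    by (rule d_ballD[OF mult_boundD(1)[OF F a(1)] order_refl]) auto
  then have "(?r * ?S) powr p \<le> d_norm p (fps_nth (F * Abs_fps a)) powr p"
    using p by (simp add: powr_mult powr_powr val max_def add.commute)
  then have "?r * ?S \<le> d_norm p (fps_nth (F * Abs_fps a))"
    using p by (meson powr_less_mono2 d_norm_nonneg not_le order_less_le_trans zero_less_one)
  moreover have Kpos: "0 \<le> K"
  proof -
    have "0 \<le> K * d_norm p (fps_nth 1)"
      using mult_boundD(2)[OF F fps_one_in_d_space] d_norm_nonneg order_trans by blast
    moreover have "1 \<le> d_norm p (fps_nth 1)"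
      using norm_le_d_norm[OF fps_one_in_d_space, of 0] by simp
    ultimately show ?thesis
      by (simp add: zero_le_mult_iff)
  qed
  ultimately have "?r * ?S \<le> K * ?r"
    using mult_boundD(2)[OF F a(1)] mult_left_mono[OF a(2) Kpos] by linarith
  then show ?thesis
    using r(2) by (simp add: mult.commute)
qed

lemma mult_bound_summable:
  assumes F: "mult_bound F K"
  shows "summable (\<lambda>j. cmod (fps_nth F j))" "(\<Sum>j. cmod (fps_nth F j)) \<le> K"
proof -
  have le: "(\<Sum>j<N. cmod (fps_nth F j)) \<le> K" for N
    using mult_bound_l1[OF F, of N] sum_mono2[of "{..N}" "{..<N}" "\<lambda>j. cmod (fps_nth F j)"]
    by force
  then show s: "summable (\<lambda>j. cmod (fps_nth F j))"
    by (intro summableI_nonneg_bounded) auto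
  show "(\<Sum>j. cmod (fps_nth F j)) \<le> K"
    by (intro suminf_le_const s le)
qed

lemma mult_bound_coeff:
  assumes F: "mult_bound F K"
  shows "cmod (fps_nth F j) \<le> K"
  using mult_bound_l1[OF F, of j] member_le_sum[of j "{..j}" "\<lambda>j. cmod (fps_nth F j)"] by simp

lemma eval_summable:
  assumes "mult_bound F K" "cmod z \<le> 1"
  shows "summable (\<lambda>n. cmod (fps_nth F n * z ^ n))"
proof (rule summable_comparison_test'[where N = 0])
  show "summable (\<lambda>n. cmod (fps_nth F n))"
    using assms by (intro mult_bound_summable)
  show "norm (cmod (fps_nth F n * z ^ n)) \<le> cmod (fps_nth F n)" for n
    using assms(2) by (simp add: norm_mult norm_power mult_left_le power_le_one)
qed

lemma eval_bound:
  assumes F: "mult_bound F K" and z: "cmod z \<le> 1"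
  shows "cmod (\<Sum>n. fps_nth F n * z ^ n) \<le> K"
proof -
  have "cmod (\<Sum>n. fps_nth F n * z ^ n) \<le> (\<Sum>n. cmod (fps_nth F n * z ^ n))"
    by (rule summable_norm[OF eval_summable[OF F z]])
  also have "\<dots> \<le> (\<Sum>n. cmod (fps_nth F n))"
    using z by (intro suminf_le eval_summable[OF F z] mult_bound_summable[OF F])
      (simp add: norm_mult norm_power mult_left_le power_le_one)
  also have "\<dots> \<le> K"
    by (rule mult_bound_summable[OF F])
  finally show ?thesis .
qed

lemma eval_mult:
  assumes F: "mult_bound F K" and G: "mult_bound G L" and z: "cmod z \<le> 1"
  shows "(\<Sum>n. fps_nth (F * G) n * z ^ n) = (\<Sum>n. fps_nth F n * z ^ n) * (\<Sum>n. fps_nth G n * z ^ n)"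
proof -
  have "(\<Sum>i\<le>n. fps_nth F i * z ^ i * (fps_nth G (n - i) * z ^ (n - i))) = fps_nth (F * G) n * z ^ n" for n
  proof -
    have "fps_nth F i * z ^ i * (fps_nth G (n - i) * z ^ (n - i))
        = fps_nth F i * fps_nth G (n - i) * z ^ n" if "i \<le> n" for i
      using that by (simp add: mult_ac power_add[symmetric])
    then show ?thesis
      unfolding fps_mult_nth atLeast0AtMost sum_distrib_right by (intro sum.cong) auto
  qed
  then show ?thesis
    using Cauchy_product[OF eval_summable[OF F z] eval_summable[OF G z]] by simp
qed

lemma eval_continuous:
  assumes F: "mult_bound F K"
  shows "continuous_on (cball 0 1) (\<lambda>z. \<Sum>n. fps_nth F n * z ^ n)"
proof (rule uniform_limit_theorem)
  show "uniform_limit (cball 0 1) (\<lambda>N z. \<Sum>n<N. fps_nth F n * z ^ n)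
      (\<lambda>z. \<Sum>n. fps_nth F n * z ^ n) sequentially"
  proof (rule Weierstrass_m_test)
    show "summable (\<lambda>n. cmod (fps_nth F n))"
      by (rule mult_bound_summable[OF F])
    show "norm (fps_nth F n * z ^ n) \<le> cmod (fps_nth F n)" if "z \<in> cball 0 1" for n z
      using that by (simp add: norm_mult norm_power mult_left_le power_le_one)
  qed
qed (auto intro!: continuous_intros always_eventually)

lemma eval_const_minus:
  assumes F: "mult_bound F K" and w: "cmod w \<le> 1"
  shows "(\<Sum>n. fps_nth (fps_const z - F) n * w ^ n) = z - (\<Sum>n. fps_nth F n * w ^ n)"
proof -
  have "(\<lambda>n. coeff [:z:] n * w ^ n - fps_nth F n * w ^ n) sums (poly [:z:] w - (\<Sum>n. fps_nth F n * w ^ n))"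
    by (intro sums_diff poly_sums summable_sums summable_norm_cancel[OF eval_summable[OF F w]])
  also have "(\<lambda>n. coeff [:z:] n * w ^ n - fps_nth F n * w ^ n)
      = (\<lambda>n. fps_nth (fps_const z - F) n * w ^ n)"
    by (simp add: fun_eq_iff left_diff_distrib flip: fps_of_poly_const)
  finally show ?thesis
    by (simp add: sums_iff)
qed

text \<open>Evaluation at \<open>w\<close> is multiplicative and kills the first factor.\<close>

lemma no_inverse_at_value:
  assumes F: "mult_bound F K" and G: "mult_bound G L" and w: "cmod w \<le> 1"
  shows "(fps_const (\<Sum>n. fps_nth F n * w ^ n) - F) * G \<noteq> 1"
proof
  define z where "z = (\<Sum>n. fps_nth F n * w ^ n)"
  assume "(fps_const (\<Sum>n. fps_nth F n * w ^ n) - F) * G = 1"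
  then have eq: "(fps_const z - F) * G = 1"
    by (simp add: z_def)
  have "(\<Sum>n. fps_nth 1 n * w ^ n) = poly 1 w"
    using poly_sums[of 1 w] by (simp add: sums_iff flip: fps_of_poly_1)
  moreover have "(\<Sum>n. fps_nth 1 n * w ^ n) = 0"
    using eval_mult[OF mult_bound_diff[OF mult_bound_const[of z] F] G w] eval_const_minus[OF F w, of z]
    unfolding eq by (simp add: z_def)
  ultimately show False
    by simp
qed

section \<open>Limits of polynomials in the shift\<close>

text \<open>The power series of the closed algebra generated by the shift.\<close>

definition approximable :: "complex fps \<Rightarrow> bool" where
  "approximable F \<longleftrightarrow> (\<forall>e>0. \<exists>P. mult_bound (F - fps_of_poly P) e)"

lemma approximableD: "approximable F \<Longrightarrow> 0 < e \<Longrightarrow> \<exists>P. mult_bound (F - fps_of_poly P) e"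
  by (simp add: approximable_def)

lemma approximable_bounded:
  assumes "approximable F"
  shows "\<exists>K\<ge>0. mult_bound F K"
proof -
  obtain P where P: "mult_bound (F - fps_of_poly P) 1"
    using approximableD[OF assms, of 1] by auto
  obtain K where "0 \<le> K" "mult_bound (fps_of_poly P) K"
    using mult_bound_poly by blast
  then show ?thesis
    using mult_bound_add[OF P, of "fps_of_poly P" K] by (intro exI[of _ "1 + K"]) auto
qed

lemma approximable_poly: "approximable (fps_of_poly P)"
  unfolding approximable_def using mult_bound_mono[OF mult_bound_0]
  by (metis diff_self less_imp_le)

lemma approximable_lim:
  assumes "\<And>e. 0 < e \<Longrightarrow> \<exists>G. approximable G \<and> mult_bound (F - G) e"
  shows "approximable F"
  unfolding approximable_def
proof (intro allI impI)
  fix e :: real assume "0 < e"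
  then obtain G where G: "approximable G" "mult_bound (F - G) (e / 2)"
    using assms half_gt_zero by blast
  then obtain P where "mult_bound (G - fps_of_poly P) (e / 2)"
    using approximableD \<open>0 < e\<close> half_gt_zero by blast
  then show "\<exists>P. mult_bound (F - fps_of_poly P) e"
    using mult_bound_add[OF G(2)] by fastforce
qed

lemma approximable_add:
  assumes "approximable F" "approximable G"
  shows "approximable (F + G)"
  unfolding approximable_def
proof (intro allI impI)
  fix e :: real assume "0 < e"
  then obtain P Q where P: "mult_bound (F - fps_of_poly P) (e / 2)"
    and Q: "mult_bound (G - fps_of_poly Q) (e / 2)"
    using assms approximableD half_gt_zero by metis
  have "F + G - fps_of_poly (P + Q) = (F - fps_of_poly P) + (G - fps_of_poly Q)"
    by (simp add: fps_of_poly_add)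
  then show "\<exists>P. mult_bound (F + G - fps_of_poly P) e"
    using mult_bound_add[OF P Q] by (intro exI[of _ "P + Q"]) (simp only: field_sum_of_halves)
qed

lemma approximable_mult:
  assumes F: "approximable F" and G: "approximable G"
  shows "approximable (F * G)"
  unfolding approximable_def
proof (intro allI impI)
  fix e :: real assume "0 < e"
  obtain K where K: "0 \<le> K" "mult_bound G K"
    using approximable_bounded[OF G] by blast
  obtain P where P: "mult_bound (F - fps_of_poly P) (e / (2 * (K + 1)))"
    using approximableD[OF F] K(1) \<open>0 < e\<close> by (metis add_nonneg_pos divide_pos_pos mult_pos_pos zero_less_numeral zero_less_one)
  obtain L where L: "0 \<le> L" "mult_bound (fps_of_poly P) L"
    using mult_bound_poly by blast
  obtain Q where Q: "mult_bound (G - fps_of_poly Q) (e / (2 * (L + 1)))"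
    using approximableD[OF G] L(1) \<open>0 < e\<close> by (metis add_nonneg_pos divide_pos_pos mult_pos_pos zero_less_numeral zero_less_one)
  have eq: "F * G - fps_of_poly (P * Q)
      = G * (F - fps_of_poly P) + fps_of_poly P * (G - fps_of_poly Q)"
    by (simp add: fps_of_poly_mult algebra_simps)
  have small: "t * (e / (2 * (t + 1))) \<le> e / 2" if "0 \<le> t" for t
    using that \<open>0 < e\<close> by (simp add: field_simps)
  have "mult_bound (F * G - fps_of_poly (P * Q)) (K * (e / (2 * (K + 1))) + L * (e / (2 * (L + 1))))"
    unfolding eq using K L \<open>0 < e\<close> by (intro mult_bound_add mult_bound_mult P Q) auto
  then have "mult_bound (F * G - fps_of_poly (P * Q)) e"
    by (rule mult_bound_mono) (use small[OF K(1)] small[OF L(1)] in linarith)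
  then show "\<exists>P. mult_bound (F * G - fps_of_poly P) e"
    by blast
qed

lemma approximable_const: "approximable (fps_const c)"
  using approximable_poly[of "[:c:]"] by (simp add: fps_of_poly_const)

lemma approximable_uminus: "approximable F \<Longrightarrow> approximable (- F)"
  using approximable_mult[OF approximable_const[of "- 1"], of F] by (simp flip: fps_const_neg)

lemma approximable_diff: "approximable F \<Longrightarrow> approximable G \<Longrightarrow> approximable (F - G)"
  using approximable_add[OF _ approximable_uminus] by fastforce

lemma approximable_power: "approximable F \<Longrightarrow> approximable (F ^ k)"
  using approximable_const[of 1] by (induction k) (auto intro: approximable_mult)

lemma approximable_sum:
  assumes "finite I" "\<And>i. i \<in> I \<Longrightarrow> approximable (F i)"
  shows "approximable (\<Sum>i\<in>I. F i)"
  using assms approximable_const[of 0]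
  by (induction I rule: finite_induct) (auto intro: approximable_add)

lemma approximable_abs_summable:
  assumes s: "summable (\<lambda>j. cmod (fps_nth F j) * (real j + 1))"
  shows "approximable F"
proof (rule approximable_lim)
  fix e :: real assume "0 < e"
  let ?s = "\<lambda>j. cmod (fps_nth F j) * (real j + 1)"
  have "(\<lambda>n. \<Sum>j<n. ?s j) \<longlonglongrightarrow> suminf ?s"
    by (rule summable_LIMSEQ[OF s])
  then obtain n where n: "dist (\<Sum>j<n. ?s j) (suminf ?s) < e"
    using \<open>0 < e\<close> metric_LIMSEQ_D by blast
  define P where "P = (\<Sum>j<n. monom (fps_nth F j) j)"
  have coeff: "coeff P j = (if j < n then fps_nth F j else 0)" for j
    by (simp add: P_def coeff_sum)
  have "(\<lambda>j. ?s j - (if j \<in> {..<n} then ?s j else 0)) sums (suminf ?s - (\<Sum>j<n. ?s j))"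
    by (intro sums_diff summable_sums s sums_If_finite_set) auto
  also have "(\<lambda>j. ?s j - (if j \<in> {..<n} then ?s j else 0))
      = (\<lambda>j. cmod (fps_nth (F - fps_of_poly P) j) * (real j + 1))"
    by (auto simp: coeff)
  finally have "(\<lambda>j. cmod (fps_nth (F - fps_of_poly P) j) * (real j + 1))
      sums (suminf ?s - (\<Sum>j<n. ?s j))" .
  then have "mult_bound (F - fps_of_poly P) (suminf ?s - (\<Sum>j<n. ?s j))"
    using mult_bound_abs_summable[of "F - fps_of_poly P"] by (simp only: sums_iff)
  then have "mult_bound (F - fps_of_poly P) e"
    by (rule mult_bound_mono) (use n in \<open>simp add: dist_real_def\<close>)
  then show "\<exists>G. approximable G \<and> mult_bound (F - G) e"
    using approximable_poly by blast
qed

text \<open>Geometric decay of the coefficients beats the linear growth of the norms of the shift powers.\<close>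

lemma geometric_coeffs:
  assumes "1 < \<rho>" and F: "\<And>j. cmod (fps_nth F j) \<le> K / \<rho> ^ j"
  shows "approximable F" "mult_bound F (K / (1 - 1 / \<rho>)\<^sup>2)"
proof -
  have g: "(\<lambda>j. K * (real (Suc j) * (1 / \<rho>) ^ j)) sums (K * (1 / (1 - 1 / \<rho>)\<^sup>2))"
    using \<open>1 < \<rho>\<close> by (intro sums_mult geometric_deriv_sums) auto
  have le: "cmod (fps_nth F j) * (real j + 1) \<le> K * (real (Suc j) * (1 / \<rho>) ^ j)" for j
    using mult_right_mono[OF F[of j], of "real j + 1"] by (simp add: power_one_over field_simps)
  have s: "summable (\<lambda>j. cmod (fps_nth F j) * (real j + 1))"
    by (rule summable_comparison_test'[OF sums_summable[OF g], of 0]) (use le in simp)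
  show "approximable F"
    by (rule approximable_abs_summable[OF s])
  have "(\<Sum>j. cmod (fps_nth F j) * (real j + 1)) \<le> K * (1 / (1 - 1 / \<rho>)\<^sup>2)"
    using suminf_le[OF le s sums_summable[OF g]] g by (simp add: sums_iff)
  then show "mult_bound F (K / (1 - 1 / \<rho>)\<^sup>2)"
    using mult_bound_mono[OF mult_bound_abs_summable[OF s]] by simp
qed

section \<open>Inverting limits of polynomials\<close>

text \<open>The Neumann series of Newman's proof of Wiener's lemma, \<open>1 / B = \<Sum>k. (- R)^k / Q^(k + 1)\<close>.
  The terms are controlled in norm and the limit is taken coefficientwise; that the limit inverts
  \<open>B\<close> follows from the exact formula for the product of \<open>B\<close> with a partial sum.\<close>

lemma approximable_invertible:
  assumes B: "approximable B"
    and nz: "\<And>z. cmod z \<le> 1 \<Longrightarrow> (\<Sum>n. fps_nth B n * z ^ n) \<noteq> 0"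
  shows "\<exists>C. approximable C \<and> B * C = 1"
proof -
  obtain K where K: "mult_bound B K"
    using approximable_bounded[OF B] by blast
  let ?f = "\<lambda>z. \<Sum>n. fps_nth B n * z ^ n"
  have "\<exists>z0\<in>cball 0 1. \<forall>z\<in>cball 0 1. cmod (?f z0) \<le> cmod (?f z)"
    by (intro continuous_attains_inf continuous_on_norm eval_continuous[OF K]) auto
  then obtain z0 where z0: "cmod z0 \<le> 1" "\<And>z. cmod z \<le> 1 \<Longrightarrow> cmod (?f z0) \<le> cmod (?f z)"
    by auto
  define \<delta> where "\<delta> = cmod (?f z0)"
  have \<delta>: "0 < \<delta>" "\<And>z. cmod z \<le> 1 \<Longrightarrow> \<delta> \<le> cmod (?f z)"
    using nz[OF z0(1)] z0(2) by (simp_all add: \<delta>_def)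
  obtain Q where Q: "mult_bound (B - fps_of_poly Q) (\<delta> / 4)"
    using approximableD[OF B, of "\<delta> / 4"] \<delta>(1) by auto
  define R where "R = B - fps_of_poly Q"
  \<comment> \<open>On the disc the modulus of \<open>B - Q\<close> is bounded by its operator norm.\<close>
  have "3 * \<delta> / 4 \<le> cmod (poly Q z)" if z: "cmod z \<le> 1" for z
  proof -
    have "(\<lambda>n. fps_nth B n * z ^ n - coeff Q n * z ^ n) sums (?f z - poly Q z)"
      by (intro sums_diff poly_sums summable_sums summable_norm_cancel[OF eval_summable[OF K z]])
    then have "?f z - poly Q z = (\<Sum>n. fps_nth (B - fps_of_poly Q) n * z ^ n)"
      by (simp add: sums_iff left_diff_distrib)
    then have "cmod (?f z - poly Q z) \<le> \<delta> / 4"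
      using eval_bound[OF Q z] by simp
    then show ?thesis
      using \<delta>(2)[OF z] norm_triangle_ineq2[of "?f z" "poly Q z"] by simp
  qed
  then have "\<exists>\<rho>>1. \<forall>z. cmod z \<le> \<rho> \<longrightarrow> \<delta> / 2 \<le> cmod (poly Q z)"
    by (rule poly_lower_bound_extends[rotated]) (use \<delta> in auto)
  then obtain \<rho> where \<rho>: "1 < \<rho>" and Q\<rho>: "\<And>z. cmod z \<le> \<rho> \<Longrightarrow> \<delta> / 2 \<le> cmod (poly Q z)"
    by blast
  define V where "V = inverse (fps_of_poly Q)"
  have QV: "fps_of_poly Q * V = 1"
  proof -
    have "coeff Q 0 \<noteq> 0"
      using Q\<rho>[of 0] \<rho> \<delta> by (auto simp: poly_0_coeff_0)
    then show ?thesis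
      unfolding V_def by (intro inverse_mult_eq_1') simp
  qed
  define M where "M = 1 / (1 - 1 / \<rho>)\<^sup>2"
  have coeff: "cmod (fps_nth (V ^ k) j) \<le> (2 / \<delta>) ^ k / \<rho> ^ j" for k j
    using inverse_poly_power_coeff_bound[of \<rho> "\<delta> / 2" Q k j] \<rho> \<delta> Q\<rho> by (simp add: V_def)
  have Vk: "approximable (V ^ k)" "mult_bound (V ^ k) ((2 / \<delta>) ^ k * M)" for k
    using geometric_coeffs[OF \<rho> coeff] by (simp_all add: M_def)
  \<comment> \<open>The bounds \<open>\<delta> / 4\<close> for \<open>R\<close> and \<open>2 / \<delta>\<close> for \<open>V\<close> give the ratio \<open>1 / 2\<close>.\<close>
  define T where "T k = (- R) ^ k * V ^ Suc k" for k
  define c where "c = 2 * M / \<delta>"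
  have T_bound: "mult_bound (T k) (c * (1 / 2) ^ k)" for k
  proof -
    have "mult_bound (T k) ((\<delta> / 4) ^ k * ((2 / \<delta>) ^ Suc k * M))"
      unfolding T_def using \<delta> Q Vk(2)[of "Suc k"]
      by (intro mult_bound_mult mult_bound_power mult_bound_uminus) (auto simp: R_def)
    moreover have "(\<delta> / 4) ^ k * ((2 / \<delta>) ^ Suc k * M) = c * (1 / 2) ^ k"
    proof -
      have "(\<delta> / 4) * (2 / \<delta>) = 1 / 2"
        using \<delta> by simp
      then have "(\<delta> / 4) ^ k * (2 / \<delta>) ^ k = (1 / 2) ^ k"
        by (simp only: power_mult_distrib[symmetric])
      then show ?thesis
        by (simp add: c_def)
    qed
    ultimately show ?thesis
      by simp
  qed
  have T_approx: "approximable (T k)" for k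
    unfolding T_def R_def
    by (intro approximable_mult approximable_power approximable_uminus approximable_diff Vk B
        approximable_poly)
  have geo: "summable (\<lambda>k. c * (1 / 2) ^ k)"
    by (intro summable_mult summable_geometric) auto
  have T_sum: "summable (\<lambda>k. fps_nth (T k) j)" for j
    by (rule summable_comparison_test'[OF geo, of 0]) (rule mult_bound_coeff[OF T_bound])
  define C where "C = Abs_fps (\<lambda>j. \<Sum>k. fps_nth (T k) j)"
  define S where "S n = (\<Sum>k<n. T k)" for n
  have S_lim: "(\<lambda>n. fps_nth (S n) j) \<longlonglongrightarrow> fps_nth C j" for j
    using summable_LIMSEQ[OF T_sum] by (simp add: S_def C_def fps_sum_nth)
  \<comment> \<open>Telescoping, because \<open>B = Q + R\<close> and \<open>Q * T (n + 1) = - R * T n\<close>.\<close>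
  have BS: "B * S n = 1 - fps_of_poly Q * T n" for n
  proof (induction n)
    case 0
    show ?case by (simp add: S_def T_def QV)
  next
    case (Suc n)
    have "fps_of_poly Q * T (Suc n) = (fps_of_poly Q * V) * (- R * T n)"
      by (simp add: T_def mult_ac)
    then have QT: "fps_of_poly Q * T (Suc n) = - R * T n"
      by (simp add: QV)
    have "B * S (Suc n) = B * S n + (R + fps_of_poly Q) * T n"
      by (simp add: S_def R_def distrib_left)
    then show ?case
      by (simp add: Suc QT distrib_right)
  qed
  have "B * C = 1"
  proof (rule fps_ext)
    fix j
    have "(\<lambda>n. fps_nth (B * S n) j) \<longlonglongrightarrow> fps_nth (B * C) j"
      unfolding fps_mult_nth by (intro tendsto_intros S_lim)
    moreover have "(\<lambda>n. fps_nth (1 - fps_of_poly Q * T n) j)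
        \<longlonglongrightarrow> fps_nth 1 j - (\<Sum>i=0..j. fps_nth (fps_of_poly Q) i * 0)"
      unfolding fps_sub_nth fps_mult_nth
      by (intro tendsto_intros summable_LIMSEQ_zero[OF T_sum])
    ultimately show "fps_nth (B * C) j = fps_nth 1 j"
      unfolding BS using LIMSEQ_unique by fastforce
  qed
  moreover have "approximable C"
  proof (rule approximable_lim)
    fix e :: real assume "0 < e"
    let ?g = "\<lambda>k. c * (1 / 2) ^ k :: real"
    have "(\<lambda>n. suminf ?g - (\<Sum>k<n. ?g k)) \<longlonglongrightarrow> suminf ?g - suminf ?g"
      by (intro tendsto_intros summable_LIMSEQ geo)
    then have "\<forall>\<^sub>F n in sequentially. suminf ?g - (\<Sum>k<n. ?g k) < e"
      using order_tendstoD(2)[of _ 0 _ e] \<open>0 < e\<close> by simp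
    then obtain n where n: "suminf ?g - (\<Sum>k<n. ?g k) < e"
      by (meson eventually_happens sequentially_bot)
    have "0 \<le> c"
      using \<delta> by (simp add: c_def M_def)
    have "mult_bound (C - S n) e"
    proof (rule mult_bound_lim)
      show "(\<lambda>m. fps_nth (S m - S n) j) \<longlonglongrightarrow> fps_nth (C - S n) j" for j
        unfolding fps_sub_nth by (intro tendsto_intros S_lim)
      have "mult_bound (S m - S n) e" if "n \<le> m" for m
      proof -
        have split: "sum h {..<m} - sum h {..<n} = sum h {n..<m}" for h :: "nat \<Rightarrow> 'x :: ab_group_add"
          using sum_diff[of "{..<m}" "{..<n}" h] that
          by (simp add: lessThan_minus_lessThan)
        have "mult_bound (S m - S n) (\<Sum>k\<in>{n..<m}. ?g k)"
          unfolding S_def split by (intro mult_bound_sum T_bound) auto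
        moreover have "(\<Sum>k\<in>{n..<m}. ?g k) \<le> e"
          using n sum_le_suminf[OF geo, of "{..<m}"] \<open>0 \<le> c\<close> split[of ?g] by simp
        ultimately show ?thesis
          by (rule mult_bound_mono)
      qed
      then show "\<forall>\<^sub>F m in sequentially. mult_bound (S m - S n) e"
        using eventually_ge_at_top[of n] by (rule eventually_mono[rotated])
    qed
    moreover have "approximable (S n)"
      unfolding S_def by (intro approximable_sum T_approx) auto
    ultimately show "\<exists>G. approximable G \<and> mult_bound (C - G) e"
      by blast
  qed
  ultimately show ?thesis
    by blast
qed

section \<open>The operator algebras in terms of power series\<close>

lemma op_alg_simps [simp]:
  "carrier (op_alg p) = bounded_ops p"
  "U \<otimes>\<^bsub>op_alg p\<^esub> V = compose (d_space p) U V"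
  "\<one>\<^bsub>op_alg p\<^esub> = (\<lambda>a\<in>d_space p. a)"
  "\<zero>\<^bsub>op_alg p\<^esub> = (\<lambda>a\<in>d_space p. \<lambda>n. 0)"
  "U \<oplus>\<^bsub>op_alg p\<^esub> V = (\<lambda>a\<in>d_space p. \<lambda>n. U a n + V a n)"
  "c \<odot>\<^bsub>op_alg p\<^esub> U = (\<lambda>a\<in>d_space p. \<lambda>n. c * U a n)"
  by (simp_all add: op_alg_def)

definition fps_op :: "complex fps \<Rightarrow> seq_op" where
  "fps_op F = mult_op p (fps_nth F)"

lemma fps_op_extensional: "fps_op F \<in> extensional (d_space p)"
  by (simp add: fps_op_def mult_op_def)

lemma bounded_ops_extensional: "bounded_ops p \<subseteq> extensional (d_space p)"
  by (auto simp: bounded_ops_def PiE_def)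

lemma fps_op_apply: "a \<in> d_space p \<Longrightarrow> fps_op F a = fps_nth (F * Abs_fps a)"
  by (simp add: fps_op_def mult_op_def conv_eq_fps fps_nth_inverse mult.commute)

lemma fps_op_eqI:
  assumes "\<And>a. a \<in> d_space p \<Longrightarrow> U a = fps_nth (F * Abs_fps a)" "U \<in> extensional (d_space p)"
  shows "U = fps_op F"
  using assms by (intro extensionalityI[of _ "d_space p"]) (auto simp: fps_op_apply fps_op_extensional)

lemma fps_op_inj: "fps_op F = fps_op G \<longleftrightarrow> F = G"
proof
  assume "fps_op F = fps_op G"
  then have "fps_op F (fps_nth 1) = fps_op G (fps_nth 1)"
    by simp
  then show "F = G"
    by (simp add: fps_op_apply fps_one_in_d_space fps_nth_inverse fps_nth_inject)
qed simp

lemma multipliers_iff: "fps_nth F \<in> multipliers p \<longleftrightarrow> (\<exists>K\<ge>0. mult_bound F K)"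
  using multiplier_bounded[of F]
  by (auto simp: multipliers_def conv_eq_fps fps_nth_inverse mult.commute mult_bound_def)

lemma fps_op_bounded: "mult_bound F K \<Longrightarrow> fps_op F \<in> bounded_ops p"
  unfolding bounded_ops_def
proof (intro CollectI conjI ballI allI)
  assume F: "mult_bound F K"
  show "fps_op F \<in> d_space p \<rightarrow>\<^sub>E d_space p"
    using mult_boundD[OF F] fps_op_extensional by (auto simp: fps_op_apply PiE_def)
  show "fps_op F (\<lambda>n. a n + b n) = (\<lambda>n. fps_op F a n + fps_op F b n)"
    if "a \<in> d_space p" "b \<in> d_space p" for a b
    using that by (simp add: fps_op_apply d_space_add fun_eq_iff fps_mult_nth distrib_left sum.distrib)
  show "fps_op F (\<lambda>n. c * a n) = (\<lambda>n. c * fps_op F a n)" if "a \<in> d_space p" for a c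
    using that by (simp add: fps_op_apply d_space_cmult fun_eq_iff fps_mult_nth sum_distrib_left mult_ac)
  show "\<exists>C. \<forall>a\<in>d_space p. d_norm p (fps_op F a) \<le> C * d_norm p a"
    using mult_boundD[OF F] by (auto simp: fps_op_apply)
qed

lemma fps_op_one: "\<one>\<^bsub>op_alg p\<^esub> = fps_op 1"
  by (rule fps_op_eqI) (auto simp: fps_nth_inverse)

lemma fps_op_smult: "c \<odot>\<^bsub>op_alg p\<^esub> fps_op F = fps_op (fps_const c * F)"
  by (rule fps_op_eqI) (auto simp: fps_op_apply mult.assoc)

lemma fps_op_add: "fps_op F \<oplus>\<^bsub>op_alg p\<^esub> fps_op G = fps_op (F + G)"
  by (rule fps_op_eqI) (auto simp: fps_op_apply distrib_right)

lemma fps_op_mult: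
  assumes "mult_bound G K"
  shows "fps_op F \<otimes>\<^bsub>op_alg p\<^esub> fps_op G = fps_op (F * G)"
  by (rule fps_op_eqI)
    (auto simp: fps_op_apply compose_def mult_boundD[OF assms] mult.assoc fps_nth_inverse)

text \<open>The negative in a module record is the additive inverse inside its carrier, hence depends on the
  algebra.  Uniqueness of the inverse needs extensionality of the operators.\<close>

lemma fps_op_minus:
  assumes add: "\<And>U V. U \<oplus>\<^bsub>A\<^esub> V = U \<oplus>\<^bsub>op_alg p\<^esub> V" and zero: "\<zero>\<^bsub>A\<^esub> = \<zero>\<^bsub>op_alg p\<^esub>"
    and ext: "carrier A \<subseteq> extensional (d_space p)" and mem: "fps_op (- F) \<in> carrier A"
  shows "fps_op G \<ominus>\<^bsub>A\<^esub> fps_op F = fps_op (G - F)"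
proof -
  have zero_eq: "fps_op 0 = \<zero>\<^bsub>op_alg p\<^esub>"
    by (rule fps_op_eqI[symmetric]) (auto simp: fun_eq_iff)
  have "\<ominus>\<^bsub>A\<^esub> fps_op F = fps_op (- F)"
    unfolding a_inv_def m_inv_def
  proof (rule the_equality)
    show "fps_op (- F) \<in> carrier (add_monoid A) \<and>
        fps_op F \<otimes>\<^bsub>add_monoid A\<^esub> fps_op (- F) = \<one>\<^bsub>add_monoid A\<^esub> \<and>
        fps_op (- F) \<otimes>\<^bsub>add_monoid A\<^esub> fps_op F = \<one>\<^bsub>add_monoid A\<^esub>"
      using mem by (simp add: add zero fps_op_add zero_eq del: op_alg_simps)
    fix V assume V: "V \<in> carrier (add_monoid A) \<and>
        fps_op F \<otimes>\<^bsub>add_monoid A\<^esub> V = \<one>\<^bsub>add_monoid A\<^esub> \<and>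
        V \<otimes>\<^bsub>add_monoid A\<^esub> fps_op F = \<one>\<^bsub>add_monoid A\<^esub>"
    then have "V a = fps_nth (- F * Abs_fps a)" if "a \<in> d_space p" for a
      using that by (auto simp: add zero fps_op_apply fun_eq_iff eq_neg_iff_add_eq_0 restrict_def
          split: if_splits dest!: spec[of _ a])
    then show "V = fps_op (- F)"
      using V ext by (intro fps_op_eqI) auto
  qed
  then show ?thesis
    by (simp add: a_minus_def add fps_op_add del: op_alg_simps)
qed

lemma abelian_monoid_op_alg: "abelian_monoid (op_alg p)"
proof (rule abelian_monoidI)
  fix U V W assume U: "U \<in> carrier (op_alg p)" and V: "V \<in> carrier (op_alg p)"
  show "U \<oplus>\<^bsub>op_alg p\<^esub> V = V \<oplus>\<^bsub>op_alg p\<^esub> U"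
    by (auto simp: fun_eq_iff add.commute)
  show "(U \<oplus>\<^bsub>op_alg p\<^esub> V) \<oplus>\<^bsub>op_alg p\<^esub> W = U \<oplus>\<^bsub>op_alg p\<^esub> (V \<oplus>\<^bsub>op_alg p\<^esub> W)"
    by (auto simp: fun_eq_iff add.assoc restrict_def)
  have U': "U \<in> extensional (d_space p)"
    using U bounded_ops_extensional by auto
  show "\<zero>\<^bsub>op_alg p\<^esub> \<oplus>\<^bsub>op_alg p\<^esub> U = U"
    using U' by (intro extensionalityI[of _ "d_space p"]) (auto simp: fun_eq_iff)
  have mem: "U a \<in> d_space p" "V a \<in> d_space p" if "a \<in> d_space p" for a
    using U V that by (auto simp: bounded_ops_def)
  have "\<exists>C. \<forall>a\<in>d_space p. d_norm p (U a) \<le> C * d_norm p a"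
    using U by (simp add: bounded_ops_def)
  then obtain K where K: "\<And>a. a \<in> d_space p \<Longrightarrow> d_norm p (U a) \<le> K * d_norm p a"
    by blast
  have "\<exists>C. \<forall>a\<in>d_space p. d_norm p (V a) \<le> C * d_norm p a"
    using V by (simp add: bounded_ops_def)
  then obtain L where L: "\<And>a. a \<in> d_space p \<Longrightarrow> d_norm p (V a) \<le> L * d_norm p a"
    by blast
  show "U \<oplus>\<^bsub>op_alg p\<^esub> V \<in> carrier (op_alg p)"
    unfolding op_alg_simps(1) bounded_ops_def
  proof (intro CollectI conjI ballI allI exI)
    show "U \<oplus>\<^bsub>op_alg p\<^esub> V \<in> d_space p \<rightarrow>\<^sub>E d_space p"
      using mem by (auto intro: d_space_add)
    show "(U \<oplus>\<^bsub>op_alg p\<^esub> V) (\<lambda>n. a n + b n)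
        = (\<lambda>n. (U \<oplus>\<^bsub>op_alg p\<^esub> V) a n + (U \<oplus>\<^bsub>op_alg p\<^esub> V) b n)"
      if "a \<in> d_space p" "b \<in> d_space p" for a b
      using U V that by (simp add: bounded_ops_def d_space_add add_ac)
    show "(U \<oplus>\<^bsub>op_alg p\<^esub> V) (\<lambda>n. c * a n) = (\<lambda>n. c * (U \<oplus>\<^bsub>op_alg p\<^esub> V) a n)"
      if "a \<in> d_space p" for a c
      using U V that by (simp add: bounded_ops_def d_space_cmult distrib_left)
    show "d_norm p ((U \<oplus>\<^bsub>op_alg p\<^esub> V) a) \<le> (K + L) * d_norm p a" if "a \<in> d_space p" for a
      using d_space_add(2)[OF mem[OF that]] K[OF that] L[OF that] that by (simp add: distrib_right)
  qed
next
  have "fps_op 0 = \<zero>\<^bsub>op_alg p\<^esub>"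
    by (rule fps_op_eqI[symmetric]) (auto simp: fun_eq_iff)
  then show "\<zero>\<^bsub>op_alg p\<^esub> \<in> carrier (op_alg p)"
    using fps_op_bounded[OF mult_bound_0] by simp
qed

lemma shift_eq: "shift p = fps_op fps_X"
  by (rule fps_op_eqI) (auto simp: shift_def fun_eq_iff split: nat.split)

lemma shift_power: "shift p [^]\<^bsub>op_alg p\<^esub> (j::nat) = fps_op (fps_X ^ j)"
proof (induction j)
  case 0
  show ?case
    by (simp only: nat_pow_def nat.rec power_0 fps_op_one)
next
  case (Suc j)
  have "shift p [^]\<^bsub>op_alg p\<^esub> Suc j = (shift p [^]\<^bsub>op_alg p\<^esub> j) \<otimes>\<^bsub>op_alg p\<^esub> shift p"
    by (simp add: nat_pow_def)
  also have "\<dots> = fps_op (fps_X ^ j * fps_X)"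
    unfolding Suc unfolding shift_eq using mult_bound_X_power[of 1] by (intro fps_op_mult) simp
  finally show ?case
    by (simp add: mult.commute)
qed

lemma shift_poly_eq: "shift_poly p c n = fps_op (fps_of_poly (\<Sum>j\<le>n. monom (c j) j))"
proof -
  interpret abelian_monoid "op_alg p"
    by (rule abelian_monoid_op_alg)
  have term_eq: "c j \<odot>\<^bsub>op_alg p\<^esub> (shift p [^]\<^bsub>op_alg p\<^esub> j) = fps_op (fps_of_poly (monom (c j) j))" for j
    by (simp add: shift_power fps_op_smult fps_of_poly_monom del: op_alg_simps)
  have closed: "fps_op (fps_of_poly P) \<in> carrier (op_alg p)" for P
    using mult_bound_poly fps_op_bounded by auto
  show ?thesis
    unfolding shift_poly_def term_eq
  proof (induction n)
    case 0
    show ?case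
      by (subst finsum_0) (use closed in auto)
  next
    case (Suc n)
    show ?case
      by (subst finsum_Suc)
        (use closed in \<open>auto simp: Suc fps_op_add fps_of_poly_add add.commute simp del: op_alg_simps\<close>)
  qed
qed

lemma shift_poly_coeff: "shift_poly p (coeff P) (degree P) = fps_op (fps_of_poly P)"
  by (simp add: shift_poly_eq poly_as_sum_of_monoms)

lemma fps_op_minus_op_alg:
  assumes "mult_bound F K"
  shows "fps_op G \<ominus>\<^bsub>op_alg p\<^esub> fps_op F = fps_op (G - F)"
  using fps_op_bounded[OF mult_bound_uminus[OF assms]]
  by (intro fps_op_minus) (use bounded_ops_extensional in simp_all)

lemma fps_op_minus_poly:
  "fps_op G \<ominus>\<^bsub>op_alg p\<^esub> fps_op (fps_of_poly P) = fps_op (G - fps_of_poly P)"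
  using mult_bound_poly fps_op_minus_op_alg by blast

lemma op_norm_le:
  assumes "mult_bound F K" "0 \<le> K"
  shows "op_norm p (fps_op F) \<le> K"
  unfolding op_norm_def
proof (rule cSUP_least)
  show "{a \<in> d_space p. d_norm p a \<le> 1} \<noteq> {}"
    by (auto intro!: exI[of _ "\<lambda>n. 0"])
  fix a assume "a \<in> {a \<in> d_space p. d_norm p a \<le> 1}"
  then show "d_norm p (fps_op F a) \<le> K"
    using mult_boundD(2)[OF assms(1), of a] mult_left_le[of "d_norm p a" K] \<open>0 \<le> K\<close>
    by (simp add: fps_op_apply)
qed

text \<open>The hypothesis ensures that the supremum defining the operator norm is that of a bounded set.\<close>

lemma mult_bound_op_norm:
  assumes F: "mult_bound F K" "0 \<le> K"
  shows "mult_bound F (op_norm p (fps_op F))"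
proof (rule mult_boundI)
  fix a assume a: "a \<in> d_space p"
  show "fps_nth (F * Abs_fps a) \<in> d_space p"
    by (rule mult_boundD[OF F(1) a])
  show "d_norm p (fps_nth (F * Abs_fps a)) \<le> op_norm p (fps_op F) * d_norm p a"
  proof (cases "d_norm p a = 0")
    case True
    then show ?thesis
      using mult_boundD(2)[OF F(1) a] by simp
  next
    case False
    then have pos: "0 < d_norm p a"
      using d_norm_nonneg[of a] by linarith
    define t where "t = inverse (complex_of_real (d_norm p a))"
    have t: "cmod t = inverse (d_norm p a)"
      using pos by (simp add: t_def norm_inverse)
    \<comment> \<open>Rescale \<open>a\<close> to norm 1.\<close>
    let ?a = "\<lambda>n. t * a n"
    have a': "?a \<in> d_space p" "d_norm p ?a = 1"
      using d_space_cmult[OF a] d_norm_cmult[OF a, of t] t pos by auto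
    have "d_norm p (fps_op F ?a) \<le> op_norm p (fps_op F)"
      unfolding op_norm_def
    proof (rule cSUP_upper)
      show "bdd_above ((\<lambda>a. d_norm p (fps_op F a)) ` {a \<in> d_space p. d_norm p a \<le> 1})"
      proof (rule bdd_aboveI2)
        fix a assume "a \<in> {a \<in> d_space p. d_norm p a \<le> 1}"
        then show "d_norm p (fps_op F a) \<le> K"
          using mult_boundD(2)[OF F(1), of a] mult_left_le[of "d_norm p a" K] F(2)
          by (simp add: fps_op_apply)
      qed
    qed (use a' in auto)
    moreover have "fps_op F ?a = (\<lambda>n. t * fps_nth (F * Abs_fps a) n)"
      using a' by (simp add: fps_op_apply fun_eq_iff fps_mult_nth sum_distrib_left mult_ac)
    ultimately show ?thesis
      using d_norm_cmult[OF mult_boundD(1)[OF F(1) a], of t] pos by (simp add: t field_simps)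
  qed
qed

lemma carrier_mult_alg: "carrier (mult_alg p) = fps_op ` {F. \<exists>K\<ge>0. mult_bound F K}"
proof -
  have "multipliers p = fps_nth ` {F. fps_nth F \<in> multipliers p}"
  proof (intro equalityI subsetI)
    fix b assume "b \<in> multipliers p"
    then show "b \<in> fps_nth ` {F. fps_nth F \<in> multipliers p}"
      by (intro image_eqI[of _ _ "Abs_fps b"]) (auto simp: Abs_fps_inverse)
  qed auto
  then show ?thesis
    by (simp add: mult_alg_def multipliers_iff fps_op_def image_image)
qed

text \<open>Polynomials in the shift are the operators of polynomials, and for multipliers a bound on the
  operator norm is the same as \<open>mult_bound\<close>.\<close>

lemma fps_op_in_shift_alg_iff: "fps_op F \<in> carrier (shift_alg p) \<longleftrightarrow> approximable F"
proof
  assume F: "fps_op F \<in> carrier (shift_alg p)"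
  then obtain K where K: "mult_bound F K" "0 \<le> K"
    by (auto simp: shift_alg_def carrier_mult_alg fps_op_inj)
  show "approximable F"
    unfolding approximable_def
  proof (intro allI impI)
    fix e :: real assume "0 < e"
    then obtain c n where "op_norm p (fps_op F \<ominus>\<^bsub>op_alg p\<^esub> shift_poly p c n) < e"
      using F by (auto simp: shift_alg_def)
    then obtain P where P: "op_norm p (fps_op (F - fps_of_poly P)) < e"
      unfolding shift_poly_eq fps_op_minus_poly by blast
    obtain L where "mult_bound (fps_of_poly P) L" "0 \<le> L"
      using mult_bound_poly by blast
    then have "mult_bound (F - fps_of_poly P) (op_norm p (fps_op (F - fps_of_poly P)))"
      using K by (intro mult_bound_op_norm[of _ "K + L"] mult_bound_diff) auto
    with P show "\<exists>P. mult_bound (F - fps_of_poly P) e"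
      using mult_bound_mono less_imp_le by blast
  qed
next
  assume F: "approximable F"
  have "\<exists>c n. op_norm p (fps_op F \<ominus>\<^bsub>op_alg p\<^esub> shift_poly p c n) < e" if "0 < e" for e
  proof -
    obtain P where "mult_bound (F - fps_of_poly P) (e / 2)"
      using approximableD[OF F, of "e / 2"] \<open>0 < e\<close> by auto
    then have "op_norm p (fps_op F \<ominus>\<^bsub>op_alg p\<^esub> shift_poly p (coeff P) (degree P)) \<le> e / 2"
      unfolding shift_poly_coeff fps_op_minus_poly using \<open>0 < e\<close> by (intro op_norm_le) auto
    moreover have "e / 2 < e"
      using \<open>0 < e\<close> by simp
    ultimately show ?thesis
      using order_le_less_trans by blast
  qed
  then show "fps_op F \<in> carrier (shift_alg p)"
    using approximable_bounded[OF F] by (auto simp: shift_alg_def carrier_mult_alg)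
qed

lemma carrier_shift_alg: "carrier (shift_alg p) = fps_op ` {F. approximable F}"
proof -
  have "carrier (shift_alg p) \<subseteq> range fps_op"
    by (auto simp: shift_alg_def carrier_mult_alg)
  then show ?thesis
    using fps_op_in_shift_alg_iff by auto
qed

section \<open>Units and spectra\<close>

lemma Units_fps_op_iff:
  assumes carrier: "carrier A = fps_op ` \<F>" and bounded: "\<And>F. F \<in> \<F> \<Longrightarrow> \<exists>K. mult_bound F K"
    and mult: "\<And>U V. U \<otimes>\<^bsub>A\<^esub> V = U \<otimes>\<^bsub>op_alg p\<^esub> V" and one: "\<one>\<^bsub>A\<^esub> = \<one>\<^bsub>op_alg p\<^esub>"
    and F: "F \<in> \<F>"
  shows "fps_op F \<in> Units A \<longleftrightarrow> (\<exists>G\<in>\<F>. F * G = 1)"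
proof -
  have "fps_op F \<otimes>\<^bsub>op_alg p\<^esub> fps_op G = \<one>\<^bsub>op_alg p\<^esub> \<longleftrightarrow> F * G = 1"
    "fps_op G \<otimes>\<^bsub>op_alg p\<^esub> fps_op F = \<one>\<^bsub>op_alg p\<^esub> \<longleftrightarrow> F * G = 1" if "G \<in> \<F>" for G
    using bounded[OF that] bounded[OF F] fps_op_mult
    by (auto simp: fps_op_one fps_op_inj mult.commute simp del: op_alg_simps)
  then show ?thesis
    using F by (auto simp: Units_def carrier mult one simp del: op_alg_simps)
qed

text \<open>An inverse \<open>U\<close> of \<open>T_F\<close> among all bounded operators is convolution with \<open>G = U(e_0)\<close>: from
  \<open>F G = 1\<close> and \<open>F (U a) = a\<close> one gets \<open>G a = G F (U a) = U a\<close>.\<close>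

lemma Units_op_alg_iff:
  assumes F: "mult_bound F K"
  shows "fps_op F \<in> Units (op_alg p) \<longleftrightarrow> (\<exists>G L. 0 \<le> L \<and> mult_bound G L \<and> F * G = 1)"
proof
  assume "fps_op F \<in> Units (op_alg p)"
  then obtain U where U: "U \<in> bounded_ops p" and FU: "fps_op F \<otimes>\<^bsub>op_alg p\<^esub> U = \<one>\<^bsub>op_alg p\<^esub>"
    by (auto simp: Units_def)
  have mem: "U a \<in> d_space p" if "a \<in> d_space p" for a
    using U that by (auto simp: bounded_ops_def)
  have FU': "F * Abs_fps (U a) = Abs_fps a" if "a \<in> d_space p" for a
  proof -
    have "fps_op F (U a) = a"
      using fun_cong[OF FU, of a] that by (simp add: compose_def)
    then have "fps_nth (F * Abs_fps (U a)) = a"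
      using mem[OF that] by (simp add: fps_op_apply)
    then show ?thesis
      by (metis fps_nth_inverse)
  qed
  define G where "G = Abs_fps (U (fps_nth 1))"
  have FG: "F * G = 1"
    using FU'[OF fps_one_in_d_space] by (simp add: G_def fps_nth_inverse)
  have "fps_nth (G * Abs_fps a) \<in> d_space p" if "a \<in> d_space p" for a
  proof -
    have "G * Abs_fps a = (F * G) * Abs_fps (U a)"
      by (simp add: FU'[OF that, symmetric] mult_ac)
    then have "fps_nth (G * Abs_fps a) = U a"
      by (simp add: FG Abs_fps_inverse)
    then show ?thesis
      using mem[OF that] by simp
  qed
  then show "\<exists>G L. 0 \<le> L \<and> mult_bound G L \<and> F * G = 1"
    using multiplier_bounded FG by blast
next
  assume "\<exists>G L. 0 \<le> L \<and> mult_bound G L \<and> F * G = 1"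
  then obtain G L where G: "mult_bound G L" and FG: "F * G = 1"
    by blast
  have "fps_op F \<otimes>\<^bsub>op_alg p\<^esub> fps_op G = \<one>\<^bsub>op_alg p\<^esub>" "fps_op G \<otimes>\<^bsub>op_alg p\<^esub> fps_op F = \<one>\<^bsub>op_alg p\<^esub>"
    unfolding fps_op_mult[OF G] fps_op_mult[OF F] by (simp_all only: FG mult.commute[of G] fps_op_one)
  then show "fps_op F \<in> Units (op_alg p)"
    using fps_op_bounded[OF F] fps_op_bounded[OF G] by (auto simp: Units_def simp del: op_alg_simps(2-))
qed

lemma spectrum_fps_op:
  assumes add: "\<And>U V. U \<oplus>\<^bsub>A\<^esub> V = U \<oplus>\<^bsub>op_alg p\<^esub> V" and zero: "\<zero>\<^bsub>A\<^esub> = \<zero>\<^bsub>op_alg p\<^esub>"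
    and smult: "\<And>c U. c \<odot>\<^bsub>A\<^esub> U = c \<odot>\<^bsub>op_alg p\<^esub> U" and one: "\<one>\<^bsub>A\<^esub> = \<one>\<^bsub>op_alg p\<^esub>"
    and ext: "carrier A \<subseteq> extensional (d_space p)" and mem: "fps_op (- F) \<in> carrier A"
  shows "spectrum A (fps_op F) = {z. fps_op (fps_const z - F) \<notin> Units A}"
proof -
  have "z \<odot>\<^bsub>A\<^esub> \<one>\<^bsub>A\<^esub> \<ominus>\<^bsub>A\<^esub> fps_op F = fps_op (fps_const z - F)" for z
    using fps_op_minus[of A, OF add zero ext mem, of "fps_const z"]
    by (simp add: smult one fps_op_one fps_op_smult del: op_alg_simps)
  then show ?thesis
    by (simp add: spectrum_def)
qed

lemma alg_sel:
  "U \<otimes>\<^bsub>mult_alg p\<^esub> V = U \<otimes>\<^bsub>op_alg p\<^esub> V" "U \<otimes>\<^bsub>shift_alg p\<^esub> V = U \<otimes>\<^bsub>op_alg p\<^esub> V"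
  "\<one>\<^bsub>mult_alg p\<^esub> = \<one>\<^bsub>op_alg p\<^esub>" "\<one>\<^bsub>shift_alg p\<^esub> = \<one>\<^bsub>op_alg p\<^esub>"
  "\<zero>\<^bsub>mult_alg p\<^esub> = \<zero>\<^bsub>op_alg p\<^esub>" "\<zero>\<^bsub>shift_alg p\<^esub> = \<zero>\<^bsub>op_alg p\<^esub>"
  "U \<oplus>\<^bsub>mult_alg p\<^esub> V = U \<oplus>\<^bsub>op_alg p\<^esub> V" "U \<oplus>\<^bsub>shift_alg p\<^esub> V = U \<oplus>\<^bsub>op_alg p\<^esub> V"
  "c \<odot>\<^bsub>mult_alg p\<^esub> U = c \<odot>\<^bsub>op_alg p\<^esub> U" "c \<odot>\<^bsub>shift_alg p\<^esub> U = c \<odot>\<^bsub>op_alg p\<^esub> U"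
  by (simp_all add: mult_alg_def shift_alg_def del: op_alg_simps)

lemma spectrum_op_alg:
  assumes F: "mult_bound F K"
  shows "spectrum (op_alg p) (fps_op F)
    = {z. \<not> (\<exists>G L. 0 \<le> L \<and> mult_bound G L \<and> (fps_const z - F) * G = 1)}"
proof -
  have "spectrum (op_alg p) (fps_op F) = {z. fps_op (fps_const z - F) \<notin> Units (op_alg p)}"
    using fps_op_bounded[OF mult_bound_uminus[OF F]]
    by (intro spectrum_fps_op) (use bounded_ops_extensional in simp_all)
  then show ?thesis
    using Units_op_alg_iff[OF mult_bound_diff[OF mult_bound_const F]] by simp
qed

lemma spectrum_mult_alg:
  assumes F: "mult_bound F K" "0 \<le> K"
  shows "spectrum (mult_alg p) (fps_op F)
    = {z. \<not> (\<exists>G L. 0 \<le> L \<and> mult_bound G L \<and> (fps_const z - F) * G = 1)}"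
proof -
  have "spectrum (mult_alg p) (fps_op F) = {z. fps_op (fps_const z - F) \<notin> Units (mult_alg p)}"
    using F mult_bound_uminus
    by (intro spectrum_fps_op) (auto simp: alg_sel carrier_mult_alg fps_op_extensional simp del: op_alg_simps)
  moreover have "fps_op (fps_const z - F) \<in> Units (mult_alg p) \<longleftrightarrow>
      (\<exists>G\<in>{G. \<exists>L\<ge>0. mult_bound G L}. (fps_const z - F) * G = 1)" for z
  proof (intro Units_fps_op_iff carrier_mult_alg)
    show "fps_const z - F \<in> {G. \<exists>L\<ge>0. mult_bound G L}"
      using mult_bound_diff[OF mult_bound_const[of z] F(1)] F(2)
      by (auto intro!: exI[of _ "cmod z + K"])
  qed (auto simp: alg_sel simp del: op_alg_simps)
  ultimately show ?thesis
    by auto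
qed

lemma spectrum_shift_alg:
  assumes F: "approximable F"
  shows "spectrum (shift_alg p) (fps_op F)
    = {z. \<not> (\<exists>G. approximable G \<and> (fps_const z - F) * G = 1)}"
proof -
  have "spectrum (shift_alg p) (fps_op F) = {z. fps_op (fps_const z - F) \<notin> Units (shift_alg p)}"
    using F approximable_uminus
    by (intro spectrum_fps_op) (auto simp: alg_sel carrier_shift_alg fps_op_extensional simp del: op_alg_simps)
  moreover have "fps_op (fps_const z - F) \<in> Units (shift_alg p) \<longleftrightarrow>
      (\<exists>G\<in>{G. approximable G}. (fps_const z - F) * G = 1)" for z
    using approximable_diff[OF approximable_const F] approximable_bounded
    by (intro Units_fps_op_iff carrier_shift_alg)
      (auto simp: alg_sel simp del: op_alg_simps)
  ultimately show ?thesis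
    by auto
qed

end

theorem proposition6p7:
  fixes p :: real and b :: "nat \<Rightarrow> complex"
  assumes "1 \<le> p"
    and "b \<in> multipliers p"
    and "(\<lambda>n. op_norm p (mult_op p b \<ominus>\<^bsub>op_alg p\<^esub> shift_poly p b n)) \<longlonglongrightarrow> 0"
  shows "spectrum (shift_alg p) (mult_op p b) = {(\<Sum>n. b n * z ^ n) | z. cmod z \<le> 1} \<and>
         {(\<Sum>n. b n * z ^ n) | z. cmod z \<le> 1} \<subseteq> spectrum (mult_alg p) (mult_op p b) \<and>
         spectrum (mult_alg p) (mult_op p b) = spectrum (op_alg p) (mult_op p b)"
proof -
  interpret d_space_exponent p
    by unfold_locales (rule assms)
  define B where "B = Abs_fps b"
  have b: "b = fps_nth B" and op: "mult_op p b = fps_op B"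
    by (simp_all add: B_def fps_op_def Abs_fps_inverse)
  obtain K where K: "0 \<le> K" "mult_bound B K"
    using assms(2) by (auto simp: b multipliers_iff)
  let ?f = "\<lambda>z. \<Sum>n. fps_nth B n * z ^ n"
  have "\<exists>c n. op_norm p (fps_op B \<ominus>\<^bsub>op_alg p\<^esub> shift_poly p c n) < e" if "0 < e" for e
    using eventually_happens'[OF sequentially_bot order_tendstoD(2)[OF assms(3) that]]
    unfolding op by blast
  then have "fps_op B \<in> carrier (shift_alg p)"
    using K by (auto simp: shift_alg_def carrier_mult_alg)
  then have B: "approximable B"
    by (simp add: fps_op_in_shift_alg_iff)
  have shift: "z \<in> spectrum (shift_alg p) (fps_op B) \<longleftrightarrow> (\<exists>w. z = ?f w \<and> cmod w \<le> 1)" for z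
  proof
    assume z: "z \<in> spectrum (shift_alg p) (fps_op B)"
    show "\<exists>w. z = ?f w \<and> cmod w \<le> 1"
    proof (rule ccontr)
      assume "\<nexists>w. z = ?f w \<and> cmod w \<le> 1"
      then have "\<exists>C. approximable C \<and> (fps_const z - B) * C = 1"
        using eval_const_minus[OF K(2), of _ z]
        by (intro approximable_invertible approximable_diff approximable_const B) auto
      then show False
        using z spectrum_shift_alg[OF B] by blast
    qed
  next
    assume "\<exists>w. z = ?f w \<and> cmod w \<le> 1"
    then show "z \<in> spectrum (shift_alg p) (fps_op B)"
      using no_inverse_at_value[OF K(2)] approximable_bounded
      unfolding spectrum_shift_alg[OF B] by blast
  qed
  have "spectrum (shift_alg p) (fps_op B) = {?f z | z. cmod z \<le> 1}"
    using shift by auto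
  moreover have "{?f z | z. cmod z \<le> 1} \<subseteq> spectrum (mult_alg p) (fps_op B)"
    using no_inverse_at_value[OF K(2)] unfolding spectrum_mult_alg[OF K(2,1)] by blast
  moreover have "spectrum (mult_alg p) (fps_op B) = spectrum (op_alg p) (fps_op B)"
    unfolding spectrum_mult_alg[OF K(2,1)] spectrum_op_alg[OF K(2)] ..
  ultimately show ?thesis
    unfolding op unfolding b by blast
qed

end
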